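(* Let $s>0$, let $(a_n)_{n=0}^\infty$ be a greedy $s$-energy sequence on $S^1$, and let $(F_{N,s})_{N\ge1}$ be the associated sequence. As $N\to\infty$, if $s\neq1$, then \[ F_{N,s}=(2^{s}-1)\frac{2\zeta(s)}{(2\pi)^s}\,G(\eta(N);s)+\begin{cases} O(N^{-s}), & 0<s<1,\\ O(N^{1-s}), & 1<s<3,\ s\neq2,\\ O(N^{-2}), & s=2 \text{ or } s>3,\\ O(N^{-2}\log N), & s=3,\end{cases} \] and if $s=1$, then \[ F_{N,1}=\frac1\pi\left(\gamma+\log(8/\pi)+\Lambda(\eta(N))\right)+O(N^{-1}). \]
   Context: Write $N\in\mathbb{N}=\{1,2,\ldots\}$ in binary as $N=2^{n_1}+2^{n_2}+\cdots+2^{n_p}$ with integers $n_1>n_2>\cdots>n_p\ge 0$, and set $\eta(N):=\left(\frac{2^{n_1}}{N},\ldots,\frac{2^{n_p}}{N}\right)$. For a vector $\vec\theta=(\theta_1,\ldots,\theta_p)$ with positive components, $G(\vec\theta;s):=\sum_{k=1}^p\theta_k^s$ and $\Lambda(\vec\theta):=\sum_{k=1}^p\theta_k\log\theta_k$. $S^1$ is the unit circle in $\mathbb{C}$. For $s>0$ let $K_s(x,y):=|x-y|^{-s}$ (with value $+\infty$ if $x=y$). A greedy $s$-energy sequence is a sequence $(a_n)_{n=0}^\infty\subset S^1$ with $a_0\in S^1$ arbitrary and, for each $n\ge1$, $a_n$ any point satisfying $\sum_{\ell=0}^{n-1}K_s(a_n,a_\ell)=\min_{x\in S^1}\sum_{\ell=0}^{n-1}K_s(x,a_\ell)$.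 Put $U_{N,s}(x):=\sum_{k=0}^{N-1}K_s(x,a_k)$, and \[ F_{N,s}:=\begin{cases}\dfrac{U_{N,s}(a_N)-N I_s(\sigma)}{N^s}, & 0<s<1,\\[0.6em] \dfrac{U_{N,1}(a_N)-\pi^{-1}N\log N}{N}, & s=1,\\[0.6em] \dfrac{U_{N,s}(a_N)}{N^s}, & s>1,\end{cases} \] where, for $0<s<1$, $I_s(\sigma)=\iint_{S^1\times S^1}|x-y|^{-s}\,d\sigma(x)\,d\sigma(y)=\frac{2^{-s}}{\sqrt\pi}\frac{\Gamma(\frac{1-s}{2})}{\Gamma(1-\frac s2)}$ and $\sigma$ is the arclength measure on $S^1$ normalized to have total mass $1$. $\zeta$ is the Riemann zeta function (analytically continued) and $\gamma$ is the Euler–Mascheroni constant. The value of $s$ is fixed in the $O$-estimates. *)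

theory Defs
  imports "HOL-Analysis.Analysis" "HOL-Probability.Probability_Measure" "HOL-Library.Landau_Symbols"
begin

definition binary_exponents :: "nat \<Rightarrow> nat list" where
  "binary_exponents N = rev (filter (bit N) [0..<N])"

lemma sorted_binary_exponents: "sorted_wrt (>) (binary_exponents N)"
  unfolding binary_exponents_def by (simp add: sorted_wrt_rev sorted_wrt_filter)

lemma sum_binary_exponents: "(\<Sum>n\<leftarrow>binary_exponents N. 2 ^ n) = N"
proof -
  have "N = take_bit N N"
    by (simp add: take_bit_nat_eq_self)
  also have "\<dots> = (\<Sum>n = 0..<N. of_bool (bit N n) * 2 ^ n)"
    by (simp flip: horner_sum_bit_eq_take_bit add: horner_sum_eq_sum lessThan_atLeast0)
  also have "\<dots> = (\<Sum>n\<leftarrow>[0..<N]. if bit N n then 2 ^ n else 0)"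
    unfolding sum_list_distinct_conv_sum_set[OF distinct_upt] by (rule sum.cong) auto
  also have "\<dots> = (\<Sum>n\<leftarrow>filter (bit N) [0..<N]. 2 ^ n)"
    by (simp add: sum_list_map_filter')
  finally show ?thesis
    by (simp add: binary_exponents_def flip: rev_map)
qed

definition eta :: "nat \<Rightarrow> real list" where
  "eta N = map (\<lambda>n. 2 ^ n / real N) (binary_exponents N)"

definition G :: "real list \<Rightarrow> real \<Rightarrow> real" where
  "G \<theta> s = (\<Sum>t\<leftarrow>\<theta>. t powr s)"

definition Lambda :: "real list \<Rightarrow> real" where
  "Lambda \<theta> = (\<Sum>t\<leftarrow>\<theta>. t * ln t)"

abbreviation circle :: "complex set" where
  "circle \<equiv> sphere 0 1"

definition riesz_kernel :: "real \<Rightarrow> complex \<Rightarrow> complex \<Rightarrow> ennreal" where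
  "riesz_kernel s x y = (if x = y then \<infinity> else ennreal (norm (x - y) powr (- s)))"

definition riesz_potential :: "real \<Rightarrow> (nat \<Rightarrow> complex) \<Rightarrow> nat \<Rightarrow> complex \<Rightarrow> ennreal" where
  "riesz_potential s a N x = (\<Sum>k<N. riesz_kernel s x (a k))"

definition greedy_energy_sequence :: "real \<Rightarrow> (nat \<Rightarrow> complex) \<Rightarrow> bool" where
  "greedy_energy_sequence s a \<longleftrightarrow>
     (\<forall>n. a n \<in> circle) \<and>
     (\<forall>n\<ge>1. \<forall>x\<in>circle. riesz_potential s a n (a n) \<le> riesz_potential s a n x)"

definition arclength_prob :: "complex measure" where
  "arclength_prob = distr (uniform_measure lborel {0..2 * pi}) borel cis"

definition riesz_energy :: "real \<Rightarrow> complex measure \<Rightarrow> ennreal" where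
  "riesz_energy s \<mu> = (\<integral>\<^sup>+x. \<integral>\<^sup>+y. riesz_kernel s x y \<partial>\<mu> \<partial>\<mu>)"

text \<open>
  Passing to real numbers is harmless below: a minimal potential over the circle is finite,
  since the circle is infinite, and the energy of the arclength measure is finite for
  \<open>0 < s < 1\<close>.
\<close>

definition F :: "real \<Rightarrow> (nat \<Rightarrow> complex) \<Rightarrow> nat \<Rightarrow> real" where
  "F s a N =
     (let U = enn2real (riesz_potential s a N (a N)) in
      if s < 1 then (U - real N * enn2real (riesz_energy s arclength_prob)) / real N powr s
      else if s = 1 then (U - real N * ln (real N) / pi) / real N
      else U / real N powr s)"

text \<open>
  By the identity theorem, such a continuation is unique on \<open>- {1}\<close>; only its (arbitrary) value
  at the pole is left open by the choice operator.
\<close>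

definition riemann_zeta :: "complex \<Rightarrow> complex" where
  "riemann_zeta = (SOME f. f holomorphic_on (- {1}) \<and>
     (\<forall>z. Re z > 1 \<longrightarrow> (\<lambda>n. 1 / of_nat (Suc n) powr z) sums f z))"

end

theory Submission
  imports Defs "HOL-Complex_Analysis.Complex_Analysis" "HOL-Real_Asymp.Real_Asymp"
begin

text \<open>
  The proof reduces the greedy potential to explicit trigonometric sums, one for each binary digit of
  \<open>N\<close>, and expands these sums.

  Reduction. By strict convexity of the kernel in the angle, the potential of the \<open>n\<close>-th roots of a unit
  complex number \<open>c\<close> is minimal on the circle exactly at the midpoints between neighbouring roots, which are
  the \<open>n\<close>-th roots of \<open>- c\<close> (\<open>roots_potential_minimum\<close>). It follows by induction that the first \<open>2 ^ n\<close>
  points of a greedy sequence form a regular polygon, and that the next \<open>2 ^ n\<close> points fill the midpoints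
  while being a greedy sequence themselves (\<open>greedy_upto_structure\<close>). The minimal potential of \<open>N\<close> points is
  therefore the sum, over the binary digits \<open>2 ^ k\<close> of \<open>N\<close>, of the potential \<open>midpoint_potential (2 ^ k) s\<close>
  of a regular polygon at a midpoint.

  Expansion. With \<open>n = 2 * M\<close> points, that potential is twice the sum of the kernel over the midpoints of \<open>M\<close>
  equal arcs of a half circle. Replacing the chord \<open>2 * sin (t / 2)\<close> by the arc \<open>t\<close> leads to
  the sum of \<open>(j + 1/2) powr (- s)\<close> over \<open>j < M\<close>, whose constant term is \<open>(2 powr s - 1) * \<zeta>(s)\<close>
  (\<open>half_integer_sum_limit\<close>). The difference of the two kernels has so mild a singularity at \<open>0\<close> that for
  \<open>s \<le> 1\<close> its sum is a Riemann sum with a small error (\<open>riemann_sum_kernel_defect\<close>), while for \<open>s > 1\<close> its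
  sum is itself an error term (\<open>sum_kernel_defect_bound\<close>). For \<open>0 < s < 1\<close> the terms linear in \<open>n\<close> combine to
  the energy of arclength, and for \<open>s = 1\<close> they give the term \<open>n * ln n\<close> and the constants.

  Summation. The main terms \<open>(2 ^ k) powr s\<close> add up to \<open>N powr s * G (eta N) s\<close>, and for \<open>s = 1\<close> the terms
  \<open>2 ^ k * ln (2 ^ k)\<close> produce \<open>Lambda (eta N)\<close>. For \<open>s \<le> 1\<close> the errors decay geometrically in \<open>k\<close> and have
  a bounded sum; for \<open>s > 1\<close> the largest digit dominates. The exponent \<open>s = 2\<close> is special because there the
  expansion is exact (\<open>midpoint_potential_dyadic_2\<close>).

  The zeta function has to be constructed first. It is continued strip by strip through a recursion
  between \<open>\<zeta>(s), \<zeta>(s + 1), \<dots>\<close> that comes from the Taylor expansion of \<open>(n + 1) powr (1 - s)\<close>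
  (\<open>zeta_recursion\<close>). Its first instance also represents \<open>\<zeta>(s)\<close> for \<open>0 < s < 1\<close> as a limit of corrected
  partial sums (\<open>riemann_zeta_real_limit\<close>).
\<close>

section \<open>The Riemann zeta function\<close>

text \<open>
  The remainder of order \<open>K\<close> in the Taylor expansion of \<open>x powr (1 - s)\<close> at \<open>n\<close>,
  evaluated at \<open>n + 1\<close>. From \<open>k = 1\<close> on, the powers of \<open>n\<close> in the expansion are the terms of the
  Dirichlet series at \<open>s, s + 1, s + 2, \<dots>\<close>.
\<close>

definition powr_remainder :: "nat \<Rightarrow> nat \<Rightarrow> complex \<Rightarrow> complex" where
  "powr_remainder K n s = of_nat (Suc n) powr (1 - s)
     - (\<Sum>k\<le>K. ((1 - s) gchoose k) * of_nat n powr (1 - s - of_nat k))"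

text \<open>
  Taylor's theorem on the segment from \<open>n\<close> to \<open>n + 1\<close>: the derivative of order \<open>K + 1\<close> is a product
  of \<open>K + 1\<close> factors, each of size at most \<open>norm s + 1 + K\<close>, times a power of \<open>x\<close> with nonpositive real
  exponent, which is largest at the left end.
\<close>

lemma norm_powr_remainder_le:
  assumes n: "n \<ge> 1" and s: "Re s \<ge> - real K"
  shows "norm (powr_remainder K n s) \<le> (norm s + 1 + real K) ^ Suc K * real n powr (- Re s - real K)"
proof -
  define f where "f i x = (\<Prod>j<i. 1 - s - of_nat j) * x powr (1 - s - of_nat i)" for i and x :: complex
  define S :: "complex set" where "S = closed_segment (of_nat n) (of_nat (Suc n))"
  have S: "\<exists>t. x = of_real t \<and> real n \<le> t" if "x \<in> S" for x
    using that closed_segment_of_real[of "real n" "real (Suc n)", where 'a=complex] unfolding S_def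
    by (auto simp: closed_segment_eq_real_ivl split: if_splits)
  have "norm (f 0 (of_nat (Suc n)) - (\<Sum>i\<le>K. f i (of_nat n) * (of_nat (Suc n) - of_nat n) ^ i / fact i))
      \<le> ((norm s + 1 + real K) ^ Suc K * real n powr (- Re s - real K)) * norm (of_nat (Suc n) - of_nat n :: complex) ^ Suc K / fact K"
  proof (rule complex_Taylor[where S = S])
    show "convex S" by (simp add: S_def)
    show "of_nat n \<in> S" "of_nat (Suc n) \<in> S" by (auto simp: S_def)
  next
    fix i x assume x: "x \<in> S"
    then obtain t where t: "x = of_real t" "real n \<le> t" using S by blast
    with n have "x \<notin> \<real>\<^sub>\<le>\<^sub>0" by auto
    have "(f i has_field_derivative (\<Prod>j<i. 1 - s - of_nat j) * ((1 - s - of_nat i) * x powr (1 - s - of_nat i - 1))) (at x)"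
      unfolding f_def by (intro DERIV_cmult has_field_derivative_powr \<open>x \<notin> \<real>\<^sub>\<le>\<^sub>0\<close>)
    also have "(\<Prod>j<i. 1 - s - of_nat j) * ((1 - s - of_nat i) * x powr (1 - s - of_nat i - 1)) = f (Suc i) x"
      by (simp add: f_def algebra_simps)
    finally show "(f i has_field_derivative f (Suc i) x) (at x within S)"
      using has_field_derivative_at_within by blast
  next
    fix x assume x: "x \<in> S"
    then obtain t where t: "x = of_real t" "real n \<le> t" using S by blast
    have "norm (f (Suc K) x) = (\<Prod>j<Suc K. norm (1 - s - of_nat j)) * t powr (- Re s - real K)"
      unfolding f_def norm_mult prod_norm[symmetric]
      by (subst norm_powr_real_powr) (use t n in auto)
    also have "\<dots> \<le> (\<Prod>j<Suc K. norm s + 1 + real K) * real n powr (- Re s - real K)"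
    proof (intro mult_mono prod_mono conjI)
      fix j assume j: "j \<in> {..<Suc K}"
      have "norm (1 - s - of_nat j) \<le> norm (1 - s) + real j" by (metis norm_of_nat norm_triangle_ineq4)
      also have "norm (1 - s) \<le> 1 + norm s" by (metis norm_one norm_triangle_ineq4)
      finally show "norm (1 - s - of_nat j) \<le> norm s + 1 + real K" using j by simp
    next
      show "t powr (- Re s - real K) \<le> real n powr (- Re s - real K)"
        by (rule powr_mono2') (use s t n in auto)
    qed (auto intro!: prod_nonneg)
    finally show "norm (f (Suc K) x) \<le> (norm s + 1 + real K) ^ Suc K * real n powr (- Re s - real K)" by simp
  qed
  also have "f 0 (of_nat (Suc n)) - (\<Sum>i\<le>K. f i (of_nat n) * (of_nat (Suc n) - of_nat n) ^ i / fact i)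
      = powr_remainder K n s"
    by (simp add: f_def powr_remainder_def gbinomial_prod_rev atLeast0LessThan)
  also have "norm (of_nat (Suc n) - of_nat n :: complex) ^ Suc K = 1" by simp
  also have "(norm s + 1 + real K) ^ Suc K * real n powr (- Re s - real K) * 1 / fact K
    \<le> (norm s + 1 + real K) ^ Suc K * real n powr (- Re s - real K) * 1 / 1"
    by (intro divide_left_mono) (auto simp: fact_ge_1)
  finally show ?thesis by simp
qed

text \<open>
  On a closed disc around a point \<open>x\<close> with \<open>Re x > 1 - K\<close>, of radius at most half the distance to
  the line \<open>Re = 1 - K\<close>, the exponent of \<open>n\<close> stays below \<open>-1\<close> uniformly. This is the majorant for the
  Weierstrass test.
\<close>

lemma norm_powr_remainder_le_on_cball:
  assumes z: "z \<in> cball x d" and d: "0 \<le> d" "d \<le> (Re x + real K - 1) / 2"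
  shows "norm (powr_remainder K (Suc n) z)
     \<le> (norm x + d + 1 + real K) ^ Suc K * real (Suc n) powr (- (1 + (Re x + real K - 1) / 2))"
proof -
  have "dist x z \<le> d" using z by simp
  moreover have "\<bar>Re x - Re z\<bar> \<le> dist x z" "norm z \<le> norm x + dist x z"
    by (metis abs_Re_le_cmod dist_norm minus_complex.simps(1))
       (metis dist_norm norm_triangle_sub norm_minus_commute)
  ultimately have *: "Re z \<ge> Re x - d" "norm z \<le> norm x + d" by auto
  hence re: "- Re z - real K \<le> - (1 + (Re x + real K - 1) / 2)" using d by argo
  have "norm (powr_remainder K (Suc n) z) \<le> (norm z + 1 + real K) ^ Suc K * real (Suc n) powr (- Re z - real K)"
  proof (rule norm_powr_remainder_le)
    show "- real K \<le> Re z" using re d by argo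
  qed simp
  also have "\<dots> \<le> (norm x + d + 1 + real K) ^ Suc K * real (Suc n) powr (- (1 + (Re x + real K - 1) / 2))"
    by (intro mult_mono power_mono powr_mono re) (use * d in auto)
  finally show ?thesis .
qed

lemma summable_Suc_powr: "c < -1 \<Longrightarrow> summable (\<lambda>n. real (Suc n) powr c)"
  by (subst summable_Suc_iff[where f = "\<lambda>n. real n powr c"]) (simp add: summable_real_powr_iff)

lemma summable_powr_remainder:
  assumes "Re s > 1 - real K"
  shows "summable (\<lambda>n. powr_remainder K (Suc n) s)"
proof (rule summable_comparison_test)
  show "summable (\<lambda>n. (norm s + 0 + 1 + real K) ^ Suc K * real (Suc n) powr (- (1 + (Re s + real K - 1) / 2)))"
    by (intro summable_mult summable_Suc_powr) (use assms in simp)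
  show "\<exists>N. \<forall>n\<ge>N. norm (powr_remainder K (Suc n) s)
      \<le> (norm s + 0 + 1 + real K) ^ Suc K * real (Suc n) powr (- (1 + (Re s + real K - 1) / 2))"
    using norm_powr_remainder_le_on_cball[of s s 0 K] assms by auto
qed

lemma holomorphic_powr_remainder [holomorphic_intros]:
  "powr_remainder K (Suc n) holomorphic_on S"
  unfolding powr_remainder_def gbinomial_prod_rev
  by (intro holomorphic_intros) auto

lemma holomorphic_suminf_powr_remainder:
  "(\<lambda>s. \<Sum>n. powr_remainder K (Suc n) s) holomorphic_on {s. Re s > 1 - real K}"
proof (rule holomorphic_uniform_sequence)
  show "open {s. Re s > 1 - real K}" by (rule open_halfspace_Re_gt)
  show "(\<lambda>s. \<Sum>n<N. powr_remainder K (Suc n) s) holomorphic_on {s. Re s > 1 - real K}" for N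
    by (intro holomorphic_intros)
next
  fix x assume x: "x \<in> {s. Re s > 1 - real K}"
  define d where "d = (Re x + real K - 1) / 2"
  have d: "d > 0" using x by (simp add: d_def)
  have "uniform_limit (cball x d) (\<lambda>N s. \<Sum>n<N. powr_remainder K (Suc n) s)
      (\<lambda>s. \<Sum>n. powr_remainder K (Suc n) s) sequentially"
  proof (rule Weierstrass_m_test)
    show "norm (powr_remainder K (Suc n) z)
       \<le> (norm x + d + 1 + real K) ^ Suc K * real (Suc n) powr (- (1 + (Re x + real K - 1) / 2))"
      if "z \<in> cball x d" for n z
      using norm_powr_remainder_le_on_cball[OF that] d by (simp add: d_def)
    show "summable (\<lambda>n. (norm x + d + 1 + real K) ^ Suc K * real (Suc n) powr (- (1 + (Re x + real K - 1) / 2)))"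
      by (intro summable_mult summable_Suc_powr) (use x in simp)
  qed
  moreover have "cball x d \<subseteq> {s. Re s > 1 - real K}"
  proof
    fix z assume "z \<in> cball x d"
    hence "\<bar>Re x - Re z\<bar> \<le> d"
      by (metis abs_Re_le_cmod dist_norm minus_complex.simps(1) mem_cball order_trans)
    thus "z \<in> {s. Re s > 1 - real K}" using x by (simp add: d_def) argo
  qed
  ultimately show "\<exists>d>0. cball x d \<subseteq> {s. Re s > 1 - real K} \<and>
      uniform_limit (cball x d) (\<lambda>N s. \<Sum>n<N. powr_remainder K (Suc n) s)
        (\<lambda>s. \<Sum>n. powr_remainder K (Suc n) s) sequentially"
    using d by blast
qed

definition dirichlet_zeta :: "complex \<Rightarrow> complex" where
  "dirichlet_zeta s = (\<Sum>n. 1 / of_nat (Suc n) powr s)"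

lemma dirichlet_zeta_sums:
  assumes "Re s > 1"
  shows "(\<lambda>n. 1 / of_nat (Suc n) powr s) sums dirichlet_zeta s"
  unfolding dirichlet_zeta_def
proof (rule summable_sums, rule summable_norm_cancel)
  have "norm (1 / of_nat (Suc n) powr s) = real (Suc n) powr (- Re s)" for n
  proof -
    have "norm ((of_nat (Suc n) :: complex) powr s) = real (Suc n) powr Re s"
      by (subst norm_powr_real_powr) auto
    thus ?thesis by (simp add: norm_divide powr_minus_divide)
  qed
  thus "summable (\<lambda>n. norm (1 / of_nat (Suc n) powr s))"
    using summable_Suc_powr[of "- Re s"] assms by simp
qed

text \<open>
  Summing the Taylor expansion of \<open>(n + 1) powr (1 - s) - n powr (1 - s)\<close> over all \<open>n \<ge> 1\<close>, the left side
  telescopes to \<open>-1\<close> and the terms of the expansion become zeta values at \<open>s, s + 1, \<dots>\<close>. Writing the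
  identity for \<open>(z - 1) * \<zeta>(z)\<close> removes all poles: the factor \<open>s + k - 2\<close> that this needs at
  \<open>z = s + k - 1\<close> is present in the binomial coefficient.
\<close>

lemma zeta_recursion:
  assumes s: "Re s > 1" and K: "K \<ge> 1"
  shows "(s - 1) * dirichlet_zeta s =
     1 - (\<Sum>k=2..K. ((1 - s) gchoose (k - 1)) / of_nat k * ((s + of_nat (k - 1) - 1) * dirichlet_zeta (s + of_nat (k - 1))))
       + (\<Sum>n. powr_remainder K (Suc n) s)"
proof -
  define c where "c k = ((1 - s) gchoose k)" for k
  have lim: "(\<lambda>n. of_nat (Suc n) powr (1 - s) :: complex) \<longlonglongrightarrow> 0"
  proof (rule tendsto_norm_zero_cancel)
    have "((\<lambda>n. real (Suc n) powr (1 - Re s)) \<longlongrightarrow> 0) sequentially"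
      using s by real_asymp
    moreover have "norm (of_nat (Suc n) powr (1 - s) :: complex) = real (Suc n) powr (1 - Re s)" for n
      by (subst norm_powr_real_powr) auto
    ultimately show "(\<lambda>n. norm (of_nat (Suc n) powr (1 - s) :: complex)) \<longlonglongrightarrow> 0" by simp
  qed
  have tel: "(\<lambda>n. of_nat (Suc (Suc n)) powr (1 - s) - of_nat (Suc n) powr (1 - s) :: complex) sums (-1)"
    using telescope_sums[OF lim] by simp
  have pw: "of_nat (Suc n) powr (1 - s - of_nat k) = 1 / of_nat (Suc n) powr (s + of_nat (k - 1))"
    if "k \<ge> 1" for n k :: nat
  proof -
    have "1 - s - of_nat k = - (s + of_nat (k - 1))" using that by (simp add: of_nat_diff)
    thus ?thesis by (metis inverse_eq_divide powr_minus)
  qed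
  have "(\<lambda>n. (\<Sum>k=1..K. c k * (1 / of_nat (Suc n) powr (s + of_nat (k - 1)))) + powr_remainder K (Suc n) s)
     sums ((\<Sum>k=1..K. c k * dirichlet_zeta (s + of_nat (k - 1))) + (\<Sum>n. powr_remainder K (Suc n) s))"
    using s K
    by (intro sums_add sums_sum sums_mult dirichlet_zeta_sums summable_sums summable_powr_remainder) auto
  also have "(\<lambda>n. (\<Sum>k=1..K. c k * (1 / of_nat (Suc n) powr (s + of_nat (k - 1)))) + powr_remainder K (Suc n) s)
      = (\<lambda>n. of_nat (Suc (Suc n)) powr (1 - s) - of_nat (Suc n) powr (1 - s))"
  proof
    fix n
    have "(\<Sum>k\<le>K. c k * of_nat (Suc n) powr (1 - s - of_nat k))
      = of_nat (Suc n) powr (1 - s) + (\<Sum>k=1..K. c k * (1 / of_nat (Suc n) powr (s + of_nat (k - 1))))"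
    proof -
      have "(\<Sum>k\<le>K. c k * of_nat (Suc n) powr (1 - s - of_nat k)) =
         c 0 * of_nat (Suc n) powr (1 - s - of_nat 0) + (\<Sum>k=1..K. c k * of_nat (Suc n) powr (1 - s - of_nat k))"
        unfolding atMost_atLeast0 by (subst sum.atLeast_Suc_atMost) auto
      also have "(\<Sum>k=1..K. c k * of_nat (Suc n) powr (1 - s - of_nat k)) = (\<Sum>k=1..K. c k * (1 / of_nat (Suc n) powr (s + of_nat (k - 1))))"
        using pw by (intro sum.cong) auto
      finally show ?thesis by (simp add: c_def)
    qed
    thus "(\<Sum>k=1..K. c k * (1 / of_nat (Suc n) powr (s + of_nat (k - 1)))) + powr_remainder K (Suc n) s
      = of_nat (Suc (Suc n)) powr (1 - s) - of_nat (Suc n) powr (1 - s)"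
      unfolding powr_remainder_def by (simp add: c_def)
  qed
  finally have "-1 = (\<Sum>k=1..K. c k * dirichlet_zeta (s + of_nat (k - 1))) + (\<Sum>n. powr_remainder K (Suc n) s)"
    using tel sums_unique2 by blast
  also have "(\<Sum>k=1..K. c k * dirichlet_zeta (s + of_nat (k - 1)))
     = (1 - s) * dirichlet_zeta s + (\<Sum>k=2..K. c k * dirichlet_zeta (s + of_nat (k - 1)))"
    using K by (subst sum.atLeast_Suc_atMost) (auto simp: c_def numeral_2_eq_2)
  also have "(\<Sum>k=2..K. c k * dirichlet_zeta (s + of_nat (k - 1)))
     = - (\<Sum>k=2..K. c (k - 1) / of_nat k * ((s + of_nat (k - 1) - 1) * dirichlet_zeta (s + of_nat (k - 1))))"
    unfolding sum_negf[symmetric]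
  proof (intro sum.cong refl)
    fix k assume "k \<in> {2..K}"
    then obtain j where k: "k = Suc j" by (cases k) auto
    have "of_nat (Suc j) * c (Suc j) = (1 - s - of_nat j) * c j"
      using gbinomial_mult_1[of "1 - s" j] by (simp add: c_def algebra_simps)
    hence "c (Suc j) = - (c j * (s + of_nat j - 1)) / of_nat (Suc j)"
      by (simp add: eq_divide_eq algebra_simps del: of_nat_Suc)
    thus "c k * dirichlet_zeta (s + of_nat (k - 1)) = - (c (k - 1) / of_nat k * ((s + of_nat (k - 1) - 1) * dirichlet_zeta (s + of_nat (k - 1))))"
      by (simp add: k)
  qed
  finally show ?thesis unfolding c_def[symmetric] by (simp add: algebra_simps)
qed


text \<open>
  The recursion expresses \<open>(s - 1) * \<zeta>(s)\<close> through its values at points at least one unit further to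
  the right and through a remainder series. With the expansion to order \<open>m + 1\<close>, that series converges
  for \<open>Re s > - m\<close>, so each application gains a strip of width one. For the first strip the sum over \<open>k\<close>
  is empty, so that the induction can start with the convergence of the Dirichlet series alone.
\<close>

lemma zeta_continuation_halfplane:
  "\<exists>g. (m > 0 \<longrightarrow> g holomorphic_on {s. Re s > 1 - real m}) \<and>
       (\<forall>s. Re s > 1 \<longrightarrow> g s = (s - 1) * dirichlet_zeta s)"
proof (induction m)
  case 0
  show ?case by (intro exI[of _ "\<lambda>s. (s - 1) * dirichlet_zeta s"]) auto
next
  case (Suc m)
  then obtain g where hol: "m > 0 \<Longrightarrow> g holomorphic_on {s. Re s > 1 - real m}"
    and g: "\<And>s. Re s > 1 \<Longrightarrow> g s = (s - 1) * dirichlet_zeta s" by blast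
  define g' where "g' s = 1 - (\<Sum>k=2..Suc m. ((1 - s) gchoose (k - 1)) / of_nat k * g (s + of_nat (k - 1)))
       + (\<Sum>n. powr_remainder (Suc m) (Suc n) s)" for s
  have "g' s = (s - 1) * dirichlet_zeta s" if "Re s > 1" for s
  proof -
    have "g (s + of_nat (k - 1)) = (s + of_nat (k - 1) - 1) * dirichlet_zeta (s + of_nat (k - 1))" for k
      using that by (intro g) simp
    thus ?thesis unfolding g'_def by (simp only:) (rule zeta_recursion[OF that, symmetric], simp)
  qed
  moreover have "g' holomorphic_on {s. Re s > 1 - real (Suc m)}"
  proof -
    have "(\<lambda>s. g (s + of_nat (k - 1))) holomorphic_on {s. Re s > 1 - real (Suc m)}" if "k \<in> {2..Suc m}" for k
    proof -
      have "g \<circ> (\<lambda>s. s + of_nat (k - 1)) holomorphic_on {s. Re s > 1 - real (Suc m)}"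
      proof (rule holomorphic_on_compose_gen)
        show "g holomorphic_on {s. Re s > 1 - real m}" using that by (intro hol) auto
      qed (use that in \<open>auto intro!: holomorphic_intros\<close>)
      thus ?thesis by (simp add: o_def)
    qed
    thus ?thesis unfolding g'_def gbinomial_prod_rev
      by (intro holomorphic_intros holomorphic_suminf_powr_remainder) auto
  qed
  ultimately show ?case by blast
qed

text \<open>
  The continuations to the half-planes agree by the identity theorem, hence glue to an entire function.
  Without this existence result the choice in the definition of \<^const>\<open>riemann_zeta\<close> would say nothing.
\<close>

lemma zeta_continuation_exists:
  "\<exists>f. f holomorphic_on (- {1}) \<and>
     (\<forall>z. Re z > 1 \<longrightarrow> (\<lambda>n. 1 / of_nat (Suc n) powr z) sums f z)"
proof -
  obtain g where hol: "\<And>m. m > 0 \<Longrightarrow> g m holomorphic_on {s. Re s > 1 - real m}"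
    and g: "\<And>m s. Re s > 1 \<Longrightarrow> g m s = (s - 1) * dirichlet_zeta s"
    using zeta_continuation_halfplane by metis
  have agree: "g m z = g l z" if "0 < m" "m \<le> l" "Re z > 1 - real m" for m l z
  proof (rule analytic_continuation_open[where f = "g m" and g = "g l" and s = "{s. Re s > 1}" and s' = "{s. Re s > 1 - real m}"])
    show "{s. Re s > 1} \<noteq> {}" by (auto intro: exI[of _ 2])
    show "g l holomorphic_on {s. Re s > 1 - real m}"
      using hol[of l] by (rule holomorphic_on_subset) (use that in auto)
  qed (use that hol g in \<open>auto simp: open_halfspace_Re_gt\<close>)
  \<comment> \<open>The index selects a half-plane that contains \<open>z\<close>.\<close>
  define h where "h z = g (nat \<lceil>2 - Re z\<rceil> + 1) z" for z
  have h: "h z = g m z" if "0 < m" "Re z > 1 - real m" for m z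
  proof (cases "m \<le> nat \<lceil>2 - Re z\<rceil> + 1")
    case True
    thus ?thesis using agree[OF that(1) _ that(2)] unfolding h_def by simp
  next
    case False
    have "Re z > 1 - real (nat \<lceil>2 - Re z\<rceil> + 1)" by linarith
    thus ?thesis using agree[of "nat \<lceil>2 - Re z\<rceil> + 1" m z] False unfolding h_def by simp
  qed
  have "h holomorphic_on (\<Union>m\<in>{0<..}. {s. Re s > 1 - real m})"
  proof (rule holomorphic_on_UN_open)
    fix m :: nat assume "m \<in> {0<..}"
    hence "m > 0" by simp
    show "h holomorphic_on {s. Re s > 1 - real m}"
      using hol[OF \<open>m > 0\<close>] h[OF \<open>m > 0\<close>] by (subst holomorphic_cong[where g = "g m"]) auto
  qed (rule open_halfspace_Re_gt)
  moreover have "z \<in> (\<Union>m\<in>{0<..}. {s. Re s > 1 - real m})" for z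
  proof -
    have "Re z > 1 - real (nat \<lceil>2 - Re z\<rceil> + 1)" by linarith
    thus ?thesis by (intro UN_I[of "nat \<lceil>2 - Re z\<rceil> + 1"]) auto
  qed
  ultimately have h_hol: "h holomorphic_on UNIV"
    using holomorphic_on_subset[of h] by blast
  have "(\<lambda>z. h z / (z - 1)) holomorphic_on (- {1})"
    by (intro holomorphic_intros holomorphic_on_subset[OF h_hol]) auto
  moreover have "h z / (z - 1) = dirichlet_zeta z" if "Re z > 1" for z
  proof -
    have "z \<noteq> 1" using that by auto
    moreover have "h z = (z - 1) * dirichlet_zeta z" using that h[of 1 z] g[of z 1] by simp
    ultimately show ?thesis by simp
  qed
  ultimately show ?thesis using dirichlet_zeta_sums
    by (intro exI[of _ "\<lambda>z. h z / (z - 1)"]) auto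
qed

lemma
  holomorphic_riemann_zeta: "riemann_zeta holomorphic_on (- {1})" and
  riemann_zeta_sums: "Re z > 1 \<Longrightarrow> (\<lambda>n. 1 / of_nat (Suc n) powr z) sums riemann_zeta z"
  using someI_ex[OF zeta_continuation_exists] unfolding riemann_zeta_def[symmetric] by blast+

text \<open>
  The recursion with the expansion to first order, extended from \<open>Re s > 1\<close> to the punctured right
  half-plane by the identity theorem.
\<close>

lemma riemann_zeta_eq_powr_remainder:
  assumes "Re s > 0" "s \<noteq> 1"
  shows "(s - 1) * riemann_zeta s = 1 + (\<Sum>n. powr_remainder 1 (Suc n) s)"
proof (rule analytic_continuation_open[where f = "\<lambda>s. (s - 1) * riemann_zeta s"
      and g = "\<lambda>s. 1 + (\<Sum>n. powr_remainder 1 (Suc n) s)"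
      and s = "{s. Re s > 1}" and s' = "{s. Re s > 0} - {1}"])
  show "{s. Re s > 1} \<noteq> {}" by (auto intro: exI[of _ 2])
  show "open ({s. Re s > 0} - {1})" by (intro open_Diff open_halfspace_Re_gt) auto
  show "connected ({s. Re s > 0} - {1})"
    by (intro connected_open_delete open_halfspace_Re_gt convex_connected convex_halfspace_Re_gt) auto
  show "(\<lambda>s. (s - 1) * riemann_zeta s) holomorphic_on {s. Re s > 0} - {1}"
    by (intro holomorphic_intros holomorphic_on_subset[OF holomorphic_riemann_zeta]) auto
  show "(\<lambda>s. 1 + (\<Sum>n. powr_remainder 1 (Suc n) s)) holomorphic_on {s. Re s > 0} - {1}"
    by (intro holomorphic_intros holomorphic_on_subset[OF holomorphic_suminf_powr_remainder[of 1]]) auto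
next
  fix z :: complex assume "z \<in> {s. Re s > 1}"
  hence z: "Re z > 1" by simp
  have "riemann_zeta z = dirichlet_zeta z"
    using riemann_zeta_sums[OF z] dirichlet_zeta_sums[OF z] sums_unique2 by blast
  thus "(z - 1) * riemann_zeta z = 1 + (\<Sum>n. powr_remainder 1 (Suc n) z)"
    using zeta_recursion[of z 1] z by simp
qed (use assms in \<open>auto simp: open_halfspace_Re_gt\<close>)

lemma riemann_zeta_real_sums:
  fixes s :: real
  assumes "s > 1"
  shows "(\<lambda>n. real (Suc n) powr (- s)) sums Re (riemann_zeta (of_real s))"
proof -
  have "(\<lambda>n. Re (1 / of_nat (Suc n) powr of_real s)) sums Re (riemann_zeta (of_real s))"
    by (rule sums_Re[OF riemann_zeta_sums]) (use assms in simp)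
  moreover have "Re (1 / of_nat (Suc n) powr of_real s) = real (Suc n) powr (- s)" for n
  proof -
    have "1 / of_nat (Suc n) powr of_real s = (of_real (1 / real (Suc n) powr s) :: complex)"
      using powr_of_real[of "real (Suc n)" s] by simp
    thus ?thesis by (simp only: Re_complex_of_real powr_minus_divide)
  qed
  ultimately show ?thesis by simp
qed

text \<open>
  In the critical strip the first-order remainder series telescopes back to partial sums of the
  divergent Dirichlet series, corrected by the antiderivative of \<open>x powr (- s)\<close>.
\<close>

lemma riemann_zeta_real_limit:
  fixes s :: real
  assumes s: "0 < s" "s < 1"
  shows "(\<lambda>M. (\<Sum>n<M. real (Suc n) powr (- s)) - real (Suc M) powr (1 - s) / (1 - s))
     \<longlonglongrightarrow> Re (riemann_zeta (of_real s))"
proof -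
  let ?r = "\<lambda>n. powr_remainder 1 (Suc n) (of_real s)"
  have r: "?r n = of_real (real (Suc (Suc n)) powr (1 - s) - real (Suc n) powr (1 - s) - (1 - s) * real (Suc n) powr (- s))" for n
  proof -
    have "of_nat k powr of_real x = (of_real (real k powr x) :: complex)" for k x
      using powr_of_real[of "real k" x] by simp
    from this[of "Suc (Suc n)" "1 - s"] this[of "Suc n" "1 - s"] this[of "Suc n" "- s"]
    show ?thesis unfolding powr_remainder_def by simp
  qed
  have sum: "(\<Sum>n<M. ?r n) = of_real (real (Suc M) powr (1 - s) - 1 - (1 - s) * (\<Sum>n<M. real (Suc n) powr (- s)))" for M
  proof (induction M)
    case (Suc M)
    have "(A - 1 - (1 - s) * S) + (B - A - (1 - s) * p) = B - 1 - (1 - s) * (S + p)" for A B S p :: real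
      by (simp add: algebra_simps)
    thus ?case unfolding sum.lessThan_Suc Suc.IH unfolding r of_real_add[symmetric] by (simp only:)
  qed simp
  have "?r sums suminf ?r" by (intro summable_sums summable_powr_remainder) (use s in auto)
  also have "suminf ?r = (of_real s - 1) * riemann_zeta (of_real s) - 1"
    using riemann_zeta_eq_powr_remainder[of "of_real s"] s by (simp add: algebra_simps)
  finally have lim: "(\<lambda>M. Re (\<Sum>n<M. ?r n)) \<longlonglongrightarrow> Re ((of_real s - 1) * riemann_zeta (of_real s) - 1)"
    unfolding sums_def by (rule tendsto_Re)
  have "(\<lambda>M. - (Re (\<Sum>n<M. ?r n) + 1) / (1 - s)) \<longlonglongrightarrow>
     - (Re ((of_real s - 1) * riemann_zeta (of_real s) - 1) + 1) / (1 - s)"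
    by (intro tendsto_divide tendsto_minus tendsto_add tendsto_const lim) (use s in auto)
  also have "- (Re ((of_real s - 1) * riemann_zeta (of_real s) - 1) + 1) / (1 - s) = Re (riemann_zeta (of_real s))"
    using s by (simp add: field_simps)
  also have "(\<lambda>M. - (Re (\<Sum>n<M. ?r n) + 1) / (1 - s))
     = (\<lambda>M. (\<Sum>n<M. real (Suc n) powr (- s)) - real (Suc M) powr (1 - s) / (1 - s))"
  proof -
    have "- ((B - 1 - (1 - s) * S) + 1) / (1 - s) = S - B / (1 - s)" for B S :: real
      using s by (simp add: field_simps)
    thus ?thesis unfolding sum Re_complex_of_real by (simp only:)
  qed
  finally show ?thesis .
qed

section \<open>The potential of the roots of unity\<close>

text \<open>
  A chord of the unit circle that subtends the angle \<open>t \<in> {0..2 * pi}\<close> has length \<open>2 * sin (t / 2)\<close>.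
\<close>

definition circle_kernel :: "real \<Rightarrow> real \<Rightarrow> real" where
  "circle_kernel s t = (2 * sin (t / 2)) powr (- s)"

text \<open>
  The potential of the \<open>n\<close>-th roots of unity at a point halfway between two neighbouring ones.
\<close>

definition midpoint_potential :: "nat \<Rightarrow> real \<Rightarrow> real" where
  "midpoint_potential n s = (\<Sum>j<n. circle_kernel s ((2 * real j + 1) * pi / real n))"

lemma circle_kernel_nonneg: "circle_kernel s t \<ge> 0"
  by (simp add: circle_kernel_def)

lemma circle_kernel_reflect: "circle_kernel s (2 * pi - t) = circle_kernel s t"
proof -
  have "(2 * pi - t) / 2 = pi - t / 2" by simp
  thus ?thesis unfolding circle_kernel_def by (simp only: sin_pi_minus)
qed

lemma cis_minus_cis: "norm (cis u - cis v) = \<bar>2 * sin ((u - v) / 2)\<bar>"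
proof -
  have "cis u - cis v = cis ((u + v) / 2) * (cis ((u - v) / 2) - cis (- ((u - v) / 2)))"
    by (simp add: right_diff_distrib cis_mult field_simps)
  also have "cis ((u - v) / 2) - cis (- ((u - v) / 2)) = \<i> * of_real (2 * sin ((u - v) / 2))"
    by (simp add: complex_eq_iff)
  finally show ?thesis by (simp add: norm_mult)
qed

lemma riesz_kernel_cis:
  assumes "0 < u - v" "u - v < 2 * pi"
  shows "riesz_kernel s (cis u) (cis v) = ennreal (circle_kernel s (u - v))"
proof -
  have "sin ((u - v) / 2) > 0" using assms by (intro sin_gt_zero) auto
  hence n: "norm (cis u - cis v) = 2 * sin ((u - v) / 2)" "cis u \<noteq> cis v"
    using cis_minus_cis[of u v] by auto
  thus ?thesis by (simp add: riesz_kernel_def circle_kernel_def)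
qed

text \<open>
  By the inequality of the arithmetic and geometric means the left side is at least \<open>2 * (a * b) powr (- s / 2)\<close>,
  where \<open>a\<close> and \<open>b\<close> are the two chords, and \<open>a * b\<close> is smaller than the square of the middle chord \<open>c\<close>,
  because \<open>sin (v + e) * sin (v - e) = (sin v)\<^sup>2 - (sin e)\<^sup>2\<close>.
\<close>

lemma circle_kernel_midpoint_convex:
  assumes s: "s > 0" and d: "0 < d" "0 < u - d" "u + d < 2 * pi"
  shows "circle_kernel s (u - d) + circle_kernel s (u + d) > 2 * circle_kernel s u"
proof -
  define v e where "v = u / 2" and "e = d / 2"
  define a b c where "a = 2 * sin (v - e)" and "b = 2 * sin (v + e)" and "c = 2 * sin v"
  have "sin (v - e) > 0" "sin (v + e) > 0" "sin v > 0" "sin e > 0"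
    using d by (auto intro!: sin_gt_zero simp: v_def e_def)
  hence pos: "a > 0" "b > 0" "c > 0" and e: "sin e > 0" by (simp_all add: a_def b_def c_def)
  have "sin (v + e) * sin (v - e) = (sin v)\<^sup>2 * (cos e)\<^sup>2 - (cos v)\<^sup>2 * (sin e)\<^sup>2"
    unfolding sin_add sin_diff by (simp add: algebra_simps power2_eq_square)
  also have "\<dots> = (sin v)\<^sup>2 - (sin e)\<^sup>2" unfolding cos_squared_eq by (simp add: algebra_simps)
  finally have "a * b = c\<^sup>2 - 4 * (sin e)\<^sup>2"
    unfolding a_def b_def c_def by (simp add: power2_eq_square algebra_simps)
  hence ab: "a * b < c\<^sup>2" using e by simp
  define x y where "x = a powr (- s / 2)" and "y = b powr (- s / 2)"
  have "c powr (- s) = (c\<^sup>2) powr (- s / 2)"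
    using pos by (simp add: powr_powr flip: powr_numeral)
  also have "\<dots> < (a * b) powr (- s / 2)"
    using ab pos s by (intro powr_less_mono2_neg) auto
  also have "\<dots> = x * y" unfolding x_def y_def by (rule powr_mult)
  finally have "2 * c powr (- s) < 2 * (x * y)" by simp
  also have "\<dots> \<le> x\<^sup>2 + y\<^sup>2" using sum_squares_bound[of x y] by simp
  also have "\<dots> = a powr (- s) + b powr (- s)"
    unfolding x_def y_def by (simp add: powr_add[symmetric] power2_eq_square)
  finally show ?thesis
    by (simp add: circle_kernel_def a_def b_def c_def v_def e_def add_divide_distrib diff_divide_distrib)
qed

text \<open>
  Reflection exchanges the offsets \<open>\<alpha>\<close> and \<open>2 * pi - \<alpha>\<close> and leaves the sum unchanged. So twice the sum
  pairs each kernel value at distance \<open>d\<close> before a midpoint with one at distance \<open>d\<close> after it, and strict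
  convexity applies to every pair.
\<close>

lemma sum_circle_kernel_ge_midpoint:
  assumes s: "s > 0" and a: "0 < \<alpha>" "\<alpha> < 2 * pi" and n: "n > 0"
  defines "H \<equiv> (\<lambda>\<alpha>. \<Sum>j<n. circle_kernel s ((\<alpha> + 2 * pi * real j) / real n))"
  shows "H \<alpha> \<ge> midpoint_potential n s" and "H \<alpha> = midpoint_potential n s \<Longrightarrow> \<alpha> = pi"
proof -
  have mid: "midpoint_potential n s = H pi"
    unfolding midpoint_potential_def H_def by (intro sum.cong) (auto simp: algebra_simps)
  have refl: "H (2 * pi - \<alpha>) = H \<alpha>"
  proof -
    have "H \<alpha> = (\<Sum>j<n. circle_kernel s ((\<alpha> + 2 * pi * real (n - Suc j)) / real n))"
      unfolding H_def by (rule sum.nat_diff_reindex[symmetric])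
    also have "\<dots> = H (2 * pi - \<alpha>)" unfolding H_def
    proof (intro sum.cong refl)
      fix j assume "j \<in> {..<n}"
      hence "(\<alpha> + 2 * pi * real (n - Suc j)) / real n = 2 * pi - (2 * pi - \<alpha> + 2 * pi * real j) / real n"
        by (simp add: of_nat_diff field_simps)
      thus "circle_kernel s ((\<alpha> + 2 * pi * real (n - Suc j)) / real n) = circle_kernel s ((2 * pi - \<alpha> + 2 * pi * real j) / real n)"
        by (simp only: circle_kernel_reflect)
    qed
    finally show ?thesis by simp
  qed
  have strict: "H \<alpha> > H pi" if "\<alpha> \<noteq> pi"
  proof -
    define d where "d = \<bar>pi - \<alpha>\<bar>"
    have H2: "H (pi - d) = H \<alpha>" "H (pi + d) = H \<alpha>"
      using refl by (auto simp: d_def abs_if algebra_simps)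
    have "2 * H pi = (\<Sum>j<n. 2 * circle_kernel s ((pi + 2 * pi * real j) / real n))"
      by (simp add: H_def sum_distrib_left)
    also have "\<dots> < (\<Sum>j<n. circle_kernel s ((pi - d + 2 * pi * real j) / real n) + circle_kernel s ((pi + d + 2 * pi * real j) / real n))"
    proof (rule sum_strict_mono)
      fix j assume j: "j \<in> {..<n}"
      define u where "u = (pi + 2 * pi * real j) / real n"
      have d: "d > 0" "d < pi" using that a by (auto simp: d_def)
      have "pi + 2 * pi * real j - d > 0" 
      proof -
        have "0 \<le> 2 * pi * real j" by simp
        thus ?thesis using d by linarith
      qed
      moreover have "u - d / n = (pi + 2 * pi * real j - d) / n" by (simp add: u_def diff_divide_distrib)
      ultimately have 1: "u - d / n > 0" using n by simp
      have "real j + 1 \<le> real n" using j by simp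
      hence "2 * pi * (real j + 1) \<le> 2 * pi * real n" by (intro mult_left_mono) auto
      hence "pi + 2 * pi * real j + d < 2 * pi * real n" using d by (simp add: algebra_simps)
      moreover have "u + d / n = (pi + 2 * pi * real j + d) / n" by (simp add: u_def add_divide_distrib)
      ultimately have 2: "u + d / n < 2 * pi" using n by (simp add: pos_divide_less_eq)
      have "2 * circle_kernel s u < circle_kernel s (u - d / n) + circle_kernel s (u + d / n)"
        using circle_kernel_midpoint_convex[OF s _ 1 2] d n by simp
      thus "2 * circle_kernel s ((pi + 2 * pi * real j) / real n)
          < circle_kernel s ((pi - d + 2 * pi * real j) / real n) + circle_kernel s ((pi + d + 2 * pi * real j) / real n)"
        by (simp add: u_def add_divide_distrib diff_divide_distrib algebra_simps)
    qed (use n in auto)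
    also have "\<dots> = H (pi - d) + H (pi + d)" by (simp add: H_def sum.distrib)
    finally show ?thesis using H2 by simp
  qed
  show "H \<alpha> \<ge> midpoint_potential n s" using strict mid by (cases "\<alpha> = pi") auto
  show "\<alpha> = pi" if "H \<alpha> = midpoint_potential n s" using strict mid that by fastforce
qed

text \<open>
  The angle \<open>\<alpha>\<close> of \<open>x ^ n / c\<close> is \<open>n\<close> times the angle from \<open>x\<close> back to the nearest preceding root, so it
  parametrizes all angular distances from \<open>x\<close> to the roots.
\<close>

lemma roots_potential_eq:
  assumes n: "n > 0" and x: "x \<in> circle" and c: "x ^ n = c * cis \<alpha>" and a: "0 < \<alpha>" "\<alpha> < 2 * pi"
  shows "(\<Sum>y | y ^ n = c. riesz_kernel s x y)
     = ennreal (\<Sum>j<n. circle_kernel s ((\<alpha> + 2 * pi * real j) / real n))"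
proof -
  obtain u where u: "x = cis u" using x by (metis complex_norm_eq_1_exp mem_sphere_0 cis_conv_exp)
  define v where "v j = u - (\<alpha> + 2 * pi * real j) / real n" for j
  have c': "c = cis (u * real n - \<alpha>)"
  proof -
    have "c = (c * cis \<alpha>) * cis (- \<alpha>)" by (simp add: cis_mult)
    also have "\<dots> = cis u ^ n * cis (- \<alpha>)" using c u by simp
    also have "\<dots> = cis (u * real n - \<alpha>)" unfolding Complex.DeMoivre cis_mult by (simp add: algebra_simps)
    finally show ?thesis .
  qed
  have range: "0 < u - v j" "u - v j < 2 * pi" if "j < n" for j
  proof -
    have "0 < \<alpha> + 2 * pi * real j" using a by (simp add: add_pos_nonneg)
    thus "0 < u - v j" using n by (simp add: v_def)
    have "real j + 1 \<le> real n" using that by simp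
    hence "2 * pi * (real j + 1) \<le> 2 * pi * real n" by (intro mult_left_mono) auto
    thus "u - v j < 2 * pi" using n a by (simp add: v_def field_simps)
  qed
  have root: "cis (v j) ^ n = c" for j
  proof -
    have "cis (v j) ^ n = cis (u * real n - \<alpha>) * cis (- (2 * pi * real j))"
      unfolding Complex.DeMoivre cis_mult using n by (simp add: v_def right_diff_distrib mult.commute diff_diff_eq)
    also have "cis (- (2 * pi * real j)) = 1"
      using cis_multiple_2pi[of "- real j"] by (simp add: Ints_of_nat)
    finally show ?thesis using c' by simp
  qed
  have inj: "inj_on (\<lambda>j. cis (v j)) {..<n}"
  proof (rule inj_onI, rule ccontr)
    fix i j assume ij: "i \<in> {..<n}" "j \<in> {..<n}" "cis (v i) = cis (v j)" "i \<noteq> j"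
    have *: False if "i < j" "j < n" "cis (v i) = cis (v j)" for i j
    proof -
      have "v i - v j = 2 * pi * (real j - real i) / real n" by (simp add: v_def diff_divide_distrib[symmetric] algebra_simps)
      moreover have "0 < 2 * pi * (real j - real i) / real n" using that n by simp
      moreover have "v i - v j < 2 * pi"
        using range(1)[of i] range(2)[of j] that by simp
      ultimately have "0 < v i - v j" "v i - v j < 2 * pi" by auto
      hence "sin ((v i - v j) / 2) > 0" by (intro sin_gt_zero) auto
      thus False using cis_minus_cis[of "v i" "v j"] that by simp
    qed
    show False using *[of i j] *[of j i] ij by (cases "i < j") auto
  qed
  have "c \<noteq> 0" using c' by simp
  hence fin: "finite {y. y ^ n = c}" "card {y. y ^ n = c} = n"
    using n by (auto simp: finite_nth_roots card_nth_roots)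
  have "(\<lambda>j. cis (v j)) ` {..<n} = {y. y ^ n = c}"
    by (rule card_subset_eq) (use fin root inj in \<open>auto simp: card_image\<close>)
  hence "(\<Sum>y | y ^ n = c. riesz_kernel s x y) = (\<Sum>j<n. riesz_kernel s x (cis (v j)))"
    using sum.reindex[OF inj, of "riesz_kernel s x"] by (simp add: o_def)
  also have "\<dots> = (\<Sum>j<n. ennreal (circle_kernel s ((\<alpha> + 2 * pi * real j) / real n)))"
    unfolding u using range by (intro sum.cong refl) (subst riesz_kernel_cis, auto simp: v_def)
  also have "\<dots> = ennreal (\<Sum>j<n. circle_kernel s ((\<alpha> + 2 * pi * real j) / real n))"
    by (intro sum_ennreal) (simp add: circle_kernel_nonneg)
  finally show ?thesis .
qed

lemma roots_potential_at_midpoint: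
  assumes n: "n > 0" and x: "x \<in> circle" "x ^ n = - c"
  shows "(\<Sum>y | y ^ n = c. riesz_kernel s x y) = ennreal (midpoint_potential n s)"
proof -
  have "(\<Sum>y | y ^ n = c. riesz_kernel s x y) = ennreal (\<Sum>j<n. circle_kernel s ((pi + 2 * pi * real j) / real n))"
    using assms by (intro roots_potential_eq) auto
  thus ?thesis unfolding midpoint_potential_def by (simp add: algebra_simps)
qed

text \<open>
  The midpoints between neighbouring \<open>n\<close>-th roots of \<open>c\<close> are the \<open>n\<close>-th roots of \<open>- c\<close>; they are the only
  minimizers on the circle.
\<close>

lemma roots_potential_minimum:
  assumes s: "s > 0" and n: "n > 0" and x: "x \<in> circle" and c: "norm c = 1"
  shows "ennreal (midpoint_potential n s) \<le> (\<Sum>y | y ^ n = c. riesz_kernel s x y)"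
    and "(\<Sum>y | y ^ n = c. riesz_kernel s x y) \<le> ennreal (midpoint_potential n s) \<Longrightarrow> x ^ n = - c"
proof -
  have c0: "c \<noteq> 0" using c by auto
  have mp: "midpoint_potential n s \<ge> 0"
    by (simp add: midpoint_potential_def sum_nonneg circle_kernel_nonneg)
  have "ennreal (midpoint_potential n s) \<le> (\<Sum>y | y ^ n = c. riesz_kernel s x y) \<and>
     ((\<Sum>y | y ^ n = c. riesz_kernel s x y) \<le> ennreal (midpoint_potential n s) \<longrightarrow> x ^ n = - c)"
  proof (cases "x ^ n = c")
    case True
    hence "(\<Sum>y | y ^ n = c. riesz_kernel s x y) = \<infinity>"
      using finite_nth_roots[OF n, of c] by (subst sum.remove[of _ x]) (auto simp: riesz_kernel_def)
    thus ?thesis by (simp add: top_unique)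
  next
    case False
    \<comment> \<open>At a root the potential is infinite; elsewhere this angle lies strictly between \<open>0\<close> and \<open>2 * pi\<close>.\<close>
    define \<alpha> where "\<alpha> = Arg2pi (x ^ n / c)"
    have "x ^ n / c = cis \<alpha>"
      using Arg2pi[of "x ^ n / c"] x c by (simp add: \<alpha>_def norm_divide norm_power cis_conv_exp is_Arg_def)
    hence xc: "x ^ n = c * cis \<alpha>" using c0 by (simp add: field_simps)
    have a: "0 < \<alpha>" "\<alpha> < 2 * pi"
    proof -
      have "\<alpha> \<noteq> 0" using xc False by auto
      thus "0 < \<alpha>" "\<alpha> < 2 * pi" using Arg2pi[of "x ^ n / c"] by (auto simp: \<alpha>_def)
    qed
    note eq = roots_potential_eq[OF n x xc a, of s]
    have nn: "(\<Sum>j<n. circle_kernel s ((\<alpha> + 2 * pi * real j) / real n)) \<ge> 0"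
      by (simp add: sum_nonneg circle_kernel_nonneg)
    show ?thesis unfolding eq
      using sum_circle_kernel_ge_midpoint[OF s a n] xc nn mp by (auto simp: ennreal_le_iff)
  qed
  thus "ennreal (midpoint_potential n s) \<le> (\<Sum>y | y ^ n = c. riesz_kernel s x y)"
    and "(\<Sum>y | y ^ n = c. riesz_kernel s x y) \<le> ennreal (midpoint_potential n s) \<Longrightarrow> x ^ n = - c" by auto
qed

section \<open>The structure of greedy sequences\<close>

text \<open>
  The minimum over the circle of the potential of \<open>N\<close> greedily chosen points.
\<close>

definition greedy_value :: "real \<Rightarrow> nat \<Rightarrow> real" where
  "greedy_value s N = (\<Sum>k | bit N k. midpoint_potential (2 ^ k) s)"

lemma midpoint_potential_nonneg: "midpoint_potential n s \<ge> 0"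
  by (simp add: midpoint_potential_def sum_nonneg circle_kernel_nonneg)

lemma greedy_value_nonneg: "greedy_value s N \<ge> 0"
  by (simp add: greedy_value_def sum_nonneg midpoint_potential_nonneg)

lemma bit_nat_imp_power_le: "bit (N::nat) k \<Longrightarrow> 2 ^ k \<le> N"
  unfolding bit_iff_odd by (metis div_less even_zero linorder_not_less)

lemma finite_bits_nat: "finite {k. bit (N::nat) k}"
proof (rule finite_subset)
  show "{k. bit N k} \<subseteq> {..<N}"
    using bit_nat_imp_power_le less_exp order_less_le_trans by blast
qed simp

lemma greedy_value_add_power:
  assumes "j < 2 ^ n"
  shows "greedy_value s (2 ^ n + j) = midpoint_potential (2 ^ n) s + greedy_value s j"
proof -
  have nb: "\<not> bit j n" using bit_nat_imp_power_le[of j n] assms by auto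
  have "2 ^ n + j = or (2 ^ n) j"
    by (rule disjunctive_add_eq_or, rule bit_eqI) (use nb in \<open>auto simp: bit_and_iff bit_exp_iff\<close>)
  hence "{k. bit (2 ^ n + j) k} = insert n {k. bit j k}"
    by (auto simp: bit_or_iff bit_exp_iff)
  thus ?thesis unfolding greedy_value_def using nb finite_bits_nat[of j] by simp
qed

lemma riesz_kernel_eq_inverse:
  assumes "s > 0"
  shows "riesz_kernel s x y = inverse (ennreal (norm (x - y) powr s))"
  using assms by (auto simp: riesz_kernel_def powr_minus inverse_ennreal)

text \<open>
  As a map into the extended nonnegative reals the potential is continuous even at its poles, since
  inversion is. This yields minimizers by compactness.
\<close>

lemma continuous_on_riesz_potential:
  assumes "s > 0"
  shows "continuous_on A (riesz_potential s a N)"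
proof -
  have "continuous_on A (\<lambda>x. \<Sum>k<N. inverse (ennreal (norm (x - a k) powr s)))"
  proof (induction N)
    case (Suc N)
    have "continuous_on A (\<lambda>x. inverse (ennreal (norm (x - a N) powr s)))"
      by (intro continuous_intros continuous_on_ennreal continuous_on_powr') (use assms in auto)
    thus ?case using Suc by (auto intro!: continuous_on_add_ennreal)
  qed simp
  thus ?thesis unfolding riesz_potential_def by (simp add: riesz_kernel_eq_inverse[OF assms])
qed

text \<open>
  The greedy condition restricted to the indices up to \<open>k\<close>. It allows the last point of a greedy
  configuration to be exchanged for another minimizer without a continuation to an infinite sequence.
\<close>

definition greedy_upto :: "real \<Rightarrow> (nat \<Rightarrow> complex) \<Rightarrow> nat \<Rightarrow> bool" where
  "greedy_upto s a k \<longleftrightarrow> (\<forall>i\<le>k. a i \<in> circle) \<and>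
     (\<forall>i. 1 \<le> i \<and> i \<le> k \<longrightarrow> (\<forall>x\<in>circle. riesz_potential s a i (a i) \<le> riesz_potential s a i x))"

lemma greedy_upto_mono: "greedy_upto s a k \<Longrightarrow> i \<le> k \<Longrightarrow> greedy_upto s a i"
  unfolding greedy_upto_def by auto

lemma riesz_potential_add:
  "riesz_potential s a (m + j) x = riesz_potential s a m x + riesz_potential s (\<lambda>i. a (m + i)) j x"
  unfolding riesz_potential_def by (induction j) (auto simp: add.assoc)


lemma ennreal_add_le_add_imp_eq:
  fixes x y :: ennreal
  assumes "ennreal p \<le> x" "ennreal v \<le> y" "x + y \<le> ennreal p + ennreal v"
  shows "x = ennreal p" and "y = ennreal v"
proof -
  have "x + ennreal v \<le> ennreal p + ennreal v" using assms by (meson add_left_mono order_trans)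
  hence "x \<le> ennreal p" by (simp add: ennreal_add_left_cancel_le add.commute)
  thus "x = ennreal p" using assms by simp
  have "ennreal p + y \<le> ennreal p + ennreal v" using assms by (meson add_right_mono order_trans)
  hence "y \<le> ennreal v" by (simp add: ennreal_add_left_cancel_le)
  thus "y = ennreal v" using assms by simp
qed

text \<open>
  By induction on \<open>n\<close>, the first \<open>2 ^ n\<close> points are the \<open>2 ^ n\<close>-th roots of some \<open>c\<close>. The potential at a
  later index \<open>2 ^ n + j\<close> is the sum of the potential of these roots and of the potential of the \<open>j\<close> points
  \<open>b\<close> that follow. Each of the two parts has its own minimum, and a common minimizer exists: by the induction
  hypothesis every minimizer of the second part lies in the set of \<open>2 ^ n\<close>-th roots of \<open>- c\<close>, which is the
  set of minimizers of the first part. Hence the minima add, every minimizer of the sum minimizes both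
  parts, and \<open>b\<close> is again greedy.
\<close>

lemma greedy_upto_structure:
  assumes s: "s > 0"
  shows "greedy_upto s a k \<Longrightarrow> k < 2 ^ n \<Longrightarrow>
     a k ^ (2 ^ n) = a 0 ^ (2 ^ n) \<and> riesz_potential s a k (a k) = ennreal (greedy_value s k)"
proof (induction n arbitrary: a k)
  case 0
  thus ?case by (simp add: riesz_potential_def greedy_value_def)
next
  case (Suc n)
  show ?case
  proof (cases "k < 2 ^ n")
    case True
    thus ?thesis using Suc.IH[OF Suc.prems(1)] by (simp add: power_mult mult.commute[of 2])
  next
    case False
    define m :: nat where "m = 2 ^ n"
    define j where "j = k - m"
    define b where "b i = a (m + i)" for i
    define c where "c = a 0 ^ m"
    have k: "k = m + j" and j: "j < m" and m: "m > 0"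
      using False Suc.prems(2) by (auto simp: m_def j_def)
    note IH = Suc.IH[folded m_def]
    have circ: "a i \<in> circle" if "i \<le> k" for i using Suc.prems(1) that by (auto simp: greedy_upto_def)
    have c: "norm c = 1" using circ[of 0] by (simp add: c_def norm_power)
    have first: "a i ^ m = c" "riesz_potential s a i (a i) \<noteq> \<infinity>" if "i < m" for i
      using IH[OF greedy_upto_mono[OF Suc.prems(1), of i] that] that k by (auto simp: c_def)
    \<comment> \<open>A repeated point would have infinite potential.\<close>
    have inj: "inj_on a {..<m}"
    proof (rule linorder_inj_onI)
      fix i l assume "i < l" "i \<in> {..<m}" "l \<in> {..<m}"
      hence "riesz_kernel s (a l) (a i) \<noteq> \<infinity>"
        using first(2)[of l] unfolding riesz_potential_def by (auto simp: sum.remove[of _ i] finite_lessThan)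
      thus "a i \<noteq> a l" by (auto simp: riesz_kernel_def)
    qed auto
    have "c \<noteq> 0" using c by auto
    hence fin: "finite {y. y ^ m = c}" "card {y. y ^ m = c} = m" "card {y. y ^ m = - c} = m"
      using m by (auto simp: finite_nth_roots card_nth_roots)
    have img: "a ` {..<m} = {y. y ^ m = c}"
      by (rule card_subset_eq) (use fin first inj in \<open>auto simp: card_image\<close>)
    have pot: "riesz_potential s a m x = (\<Sum>y | y ^ m = c. riesz_kernel s x y)" for x
      unfolding riesz_potential_def img[symmetric] sum.reindex[OF inj] by (simp add: o_def)
    have split: "riesz_potential s a (m + i) x = riesz_potential s a m x + riesz_potential s b i x" for i x
      unfolding b_def by (rule riesz_potential_add)
    have P_le: "ennreal (midpoint_potential m s) \<le> riesz_potential s a m x" if "x \<in> circle" for x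
      unfolding pot using roots_potential_minimum(1)[OF s m that c] .
    have P_eq: "riesz_potential s a m x = ennreal (midpoint_potential m s)" if "x \<in> circle" "x ^ m = - c" for x
      unfolding pot using roots_potential_at_midpoint[OF m that] .
    have b_circ: "b i \<in> circle" if "i \<le> j" for i using circ[of "m + i"] that k by (simp add: b_def)
    have b_min: "riesz_potential s a (m + i) (b i) \<le> riesz_potential s a (m + i) x" if "i \<le> j" "x \<in> circle" for i x
      using Suc.prems(1) that m k unfolding greedy_upto_def b_def by auto
    have b0: "b 0 ^ m = - c"
    proof -
      have "card {y. y ^ m = - c} > 0" using fin m by simp
      then obtain x where x: "x ^ m = - c" by (auto simp: card_gt_0_iff)
      have "norm x ^ m = 1" using x c by (metis norm_minus_cancel norm_power)
      hence "x \<in> circle" using m power_eq_iff_eq_base[of m "norm x" 1] by simp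
      hence "riesz_potential s a m (b 0) \<le> ennreal (midpoint_potential m s)"
        using b_min[of 0 x] P_eq[OF _ x] by simp
      thus ?thesis using roots_potential_minimum(2)[OF s m b_circ[of 0] c] unfolding pot by simp
    qed
    have main: "greedy_upto s b i \<and> riesz_potential s a m (b i) = ennreal (midpoint_potential m s)"
      if "i \<le> j" for i
      using that
    proof (induction i)
      case 0
      thus ?case using b_circ[of 0] P_eq[OF _ b0] by (auto simp: greedy_upto_def)
    next
      case (Suc i)
      hence gi: "greedy_upto s b i" by simp
      obtain x where x: "x \<in> circle" "\<And>y. y \<in> circle \<Longrightarrow> riesz_potential s b (Suc i) x \<le> riesz_potential s b (Suc i) y"
        using continuous_attains_inf[OF compact_sphere _ continuous_on_riesz_potential[OF s], of 0 1 b "Suc i"]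
        by (auto simp del: mem_sphere mem_sphere_0)
      \<comment> \<open>Exchanging the next point for a minimizer \<open>x\<close> of the potential of \<open>b\<close> alone keeps \<open>b\<close> greedy,
        so the induction hypothesis places \<open>x\<close> among the midpoints.\<close>
      define b' where "b' = b(Suc i := x)"
      have same: "riesz_potential s b' l = riesz_potential s b l" if "l \<le> Suc i" for l
        using that unfolding riesz_potential_def b'_def by (auto intro!: sum.cong)
      have g': "greedy_upto s b' (Suc i)"
        unfolding greedy_upto_def
      proof safe
        fix l assume "l \<le> Suc i"
        thus "b' l \<in> circle" using gi x(1) by (auto simp: b'_def greedy_upto_def le_Suc_eq)
      next
        fix l y assume l: "1 \<le> l" "l \<le> Suc i" and y: "y \<in> circle"
        have "riesz_potential s b l (b' l) \<le> riesz_potential s b l y"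
        proof (cases "l = Suc i")
          case True
          thus ?thesis using x(2)[OF y] by (simp add: b'_def)
        next
          case False
          thus ?thesis using gi l y by (auto simp: b'_def greedy_upto_def)
        qed
        thus "riesz_potential s b' l (b' l) \<le> riesz_potential s b' l y" unfolding same[OF l(2)] .
      qed
      have "Suc i < m" using Suc.prems j by simp
      from IH[OF g' this]
      have "b' (Suc i) ^ m = b' 0 ^ m" and v: "riesz_potential s b (Suc i) (b' (Suc i)) = ennreal (greedy_value s (Suc i))"
        using same[of "Suc i"] by simp_all
      hence "x ^ m = b 0 ^ m" and v: "riesz_potential s b (Suc i) x = ennreal (greedy_value s (Suc i))"
        by (simp_all add: b'_def)
      hence xm: "x ^ m = - c" using b0 by simp
      have "riesz_potential s a m (b (Suc i)) + riesz_potential s b (Suc i) (b (Suc i))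
          \<le> ennreal (midpoint_potential m s) + ennreal (greedy_value s (Suc i))"
        using b_min[OF Suc.prems x(1)] unfolding split P_eq[OF x(1) xm] v .
      note eqs = ennreal_add_le_add_imp_eq[OF P_le[OF b_circ[OF Suc.prems]] _ this]
      have "ennreal (greedy_value s (Suc i)) \<le> riesz_potential s b (Suc i) (b (Suc i))"
        using x(2)[OF b_circ[OF Suc.prems]] v by simp
      note eqs = eqs[OF this]
      have "greedy_upto s b (Suc i)"
        unfolding greedy_upto_def
      proof safe
        fix l assume "l \<le> Suc i"
        thus "b l \<in> circle" using Suc.prems b_circ[of l] by simp
      next
        fix l y assume l: "1 \<le> l" "l \<le> Suc i" and y: "y \<in> circle"
        show "riesz_potential s b l (b l) \<le> riesz_potential s b l y"
        proof (cases "l = Suc i")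
          case True
          thus ?thesis using eqs(2) x(2)[OF y] v by simp
        next
          case False
          thus ?thesis using gi l y by (auto simp: greedy_upto_def)
        qed
      qed
      thus ?case using eqs(1) by simp
    qed
    from IH[OF conjunct1[OF main[OF order_refl]] j] main[OF order_refl]
    have fin1: "b j ^ m = - c" and fin2: "riesz_potential s b j (b j) = ennreal (greedy_value s j)"
      and fin3: "riesz_potential s a m (b j) = ennreal (midpoint_potential m s)"
      using b0 by auto
    have "a k ^ 2 ^ Suc n = (b j ^ m) ^ 2" by (simp add: k b_def m_def power_mult[symmetric] mult.commute)
    also have "\<dots> = a 0 ^ 2 ^ Suc n" unfolding fin1 by (simp add: c_def m_def power_mult[symmetric] mult.commute)
    finally have "a k ^ 2 ^ Suc n = a 0 ^ 2 ^ Suc n" .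
    moreover have "riesz_potential s a k (a k) = ennreal (greedy_value s k)"
    proof -
      have "riesz_potential s a k (a k) = ennreal (midpoint_potential m s) + ennreal (greedy_value s j)"
        using split[of j "b j"] fin2 fin3 by (simp add: k b_def)
      also have "\<dots> = ennreal (midpoint_potential m s + greedy_value s j)"
        by (simp add: midpoint_potential_nonneg greedy_value_nonneg)
      also have "midpoint_potential m s + greedy_value s j = greedy_value s k"
        using greedy_value_add_power[of j n s] j by (simp add: k m_def)
      finally show ?thesis .
    qed
    ultimately show ?thesis by blast
  qed
qed

lemma greedy_potential_eq:
  assumes "s > 0" "greedy_energy_sequence s a"
  shows "riesz_potential s a N (a N) = ennreal (greedy_value s N)"
proof -
  have "greedy_upto s a N" using assms(2) by (auto simp: greedy_upto_def greedy_energy_sequence_def)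
  thus ?thesis using greedy_upto_structure[OF assms(1), of a N N] by simp
qed

section \<open>Comparison of chord and arc, and the midpoint rule\<close>

lemma powr_neg_mean_value:
  fixes u v p :: real
  assumes "0 < u" "u \<le> v" "0 \<le> p"
  shows "u powr (- p) - v powr (- p) \<le> p * u powr (- p - 1) * (v - u)"
    and "p * v powr (- p - 1) * (v - u) \<le> u powr (- p) - v powr (- p)"
proof -
  have "u powr (- p) - v powr (- p) \<le> p * u powr (- p - 1) * (v - u) \<and>
      p * v powr (- p - 1) * (v - u) \<le> u powr (- p) - v powr (- p)"
  proof (cases "u = v")
    case False
    have "\<exists>z. u < z \<and> z < v \<and> v powr (- p) - u powr (- p) = (v - u) * (- p * z powr (- p - 1))"
      by (rule MVT2) (use assms False in \<open>auto intro!: derivative_eq_intros\<close>)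
    then obtain z where z: "u < z" "z < v" "v powr (- p) - u powr (- p) = (v - u) * (- p * z powr (- p - 1))"
      by blast
    have "v powr (- p - 1) \<le> z powr (- p - 1)" "z powr (- p - 1) \<le> u powr (- p - 1)"
      using z assms by (auto intro!: powr_mono2')
    hence "p * v powr (- p - 1) * (v - u) \<le> p * z powr (- p - 1) * (v - u)"
          "p * z powr (- p - 1) * (v - u) \<le> p * u powr (- p - 1) * (v - u)"
      using assms by (auto intro!: mult_right_mono mult_left_mono)
    thus ?thesis using z(3) by (simp add: algebra_simps)
  qed auto
  thus "u powr (- p) - v powr (- p) \<le> p * u powr (- p - 1) * (v - u)"
    and "p * v powr (- p - 1) * (v - u) \<le> u powr (- p) - v powr (- p)" by auto
qed

lemma chord_bounds:
  fixes t :: real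
  assumes "0 < t" "t \<le> pi"
  shows "t / 2 \<le> 2 * sin (t / 2)" "2 * sin (t / 2) \<le> t" "t - 2 * sin (t / 2) \<le> t ^ 3"
proof -
  have "\<bar>sin (t / 2) - (\<Sum>m<3. sin_coeff m * (t / 2) ^ m)\<bar> \<le> inverse (fact 3) * \<bar>t / 2\<bar> ^ 3"
    by (rule Maclaurin_sin_bound)
  hence *: "\<bar>sin (t / 2) - t / 2\<bar> \<le> t ^ 3 / 48"
    using assms by (simp add: sin_coeff_def numeral_3_eq_3 power3_eq_cube)
  \<comment> \<open>Up to \<open>t = pi\<close> the cubic error term is at most half of the linear one.\<close>
  have "t \<le> 16 / 5" using assms pi_approx by simp
  hence "t\<^sup>2 \<le> (16 / 5)\<^sup>2" using assms by (intro power_mono) auto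
  hence "t * t\<^sup>2 \<le> t * 12" using assms by (intro mult_left_mono) (auto simp: power2_eq_square)
  hence "t ^ 3 \<le> 12 * t" by (simp add: power3_eq_cube power2_eq_square)
  thus "t / 2 \<le> 2 * sin (t / 2)" using * by argo
  have "t ^ 3 \<ge> 0" using assms by simp
  thus "t - 2 * sin (t / 2) \<le> t ^ 3" using * by argo
  show "2 * sin (t / 2) \<le> t" using sin_x_le_x[of "t / 2"] assms by simp
qed

lemma circle_kernel_le:
  assumes "0 < t" "t \<le> pi" "p \<ge> 0"
  shows "circle_kernel p t \<le> 2 powr p * t powr (- p)"
proof -
  have "circle_kernel p t \<le> (t / 2) powr (- p)"
    unfolding circle_kernel_def using chord_bounds[of t] assms by (intro powr_mono2') auto
  also have "\<dots> = 2 powr p * t powr (- p)"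
    using assms by (simp add: powr_divide powr_minus field_simps)
  finally show ?thesis .
qed

text \<open>
  Chord and arc differ by at most \<open>t ^ 3\<close> and are comparable, so by the mean value theorem their powers
  with exponent \<open>- p\<close> differ by a multiple of \<open>t powr (- p - 1) * t ^ 3\<close>.
\<close>

lemma circle_kernel_minus_powr:
  assumes "0 < t" "t \<le> pi" "p \<ge> 0"
  shows "0 \<le> circle_kernel p t - t powr (- p)"
    and "circle_kernel p t - t powr (- p) \<le> p * 2 powr (p + 1) * t powr (2 - p)"
proof -
  note ch = chord_bounds[OF assms(1,2)]
  have pos: "2 * sin (t / 2) > 0" using ch(1) assms by linarith
  show "0 \<le> circle_kernel p t - t powr (- p)"
    unfolding circle_kernel_def using ch pos assms by (auto intro!: powr_mono2')
  have "circle_kernel p t - t powr (- p) \<le> p * circle_kernel (p + 1) t * (t - 2 * sin (t / 2))"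
    using powr_neg_mean_value(1)[OF pos ch(2) assms(3)] unfolding circle_kernel_def by simp
  also have "\<dots> \<le> p * (2 powr (p + 1) * t powr (- (p + 1))) * t ^ 3"
    using ch assms circle_kernel_le[OF assms(1,2), of "p + 1"] circle_kernel_nonneg[of "p + 1" t]
    by (intro mult_mono) auto
  also have "\<dots> = p * 2 powr (p + 1) * (t powr (- (p + 1)) * t powr 3)"
    using assms by simp
  also have "t powr (- (p + 1)) * t powr 3 = t powr (2 - p)"
    by (simp add: powr_add[symmetric])
  finally show "circle_kernel p t - t powr (- p) \<le> p * 2 powr (p + 1) * t powr (2 - p)" .
qed

text \<open>
  The midpoint rule on one cell, in terms of an arbitrary antiderivative \<open>\<Phi>\<close>. Expanding \<open>\<Phi>\<close> at the
  midpoint, the terms of even order cancel in \<open>\<Phi> (m + h) - \<Phi> (m - h)\<close>.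
\<close>

lemma midpoint_rule_error:
  fixes \<Phi> \<phi> \<phi>1 \<phi>2 :: "real \<Rightarrow> real"
  assumes h: "h > 0"
    and d0: "\<And>t. t \<in> {m - h..m + h} \<Longrightarrow> (\<Phi> has_real_derivative \<phi> t) (at t)"
    and d1: "\<And>t. t \<in> {m - h..m + h} \<Longrightarrow> (\<phi> has_real_derivative \<phi>1 t) (at t)"
    and d2: "\<And>t. t \<in> {m - h..m + h} \<Longrightarrow> (\<phi>1 has_real_derivative \<phi>2 t) (at t)"
    and B: "\<And>t. t \<in> {m - h..m + h} \<Longrightarrow> \<bar>\<phi>2 t\<bar> \<le> B"
  shows "\<bar>\<Phi> (m + h) - \<Phi> (m - h) - 2 * h * \<phi> m\<bar> \<le> B * h ^ 3"
proof -
  define D where "D i = (if i = 0 then \<Phi> else if i = 1 then \<phi> else if i = 2 then \<phi>1 else \<phi>2)" for i :: nat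
  have D: "\<forall>i t. i < 3 \<and> m - h \<le> t \<and> t \<le> m + h \<longrightarrow> (D i has_real_derivative D (Suc i) t) (at t)"
  proof safe
    fix i :: nat and t assume "i < 3" "m - h \<le> t" "t \<le> m + h"
    moreover from this have "i = 0 \<or> i = 1 \<or> i = 2" by auto
    ultimately show "(D i has_real_derivative D (Suc i) t) (at t)"
      using d0[of t] d1[of t] d2[of t] unfolding D_def by auto
  qed
  have taylor: "\<exists>t\<in>{m - h..m + h}. \<Phi> x = \<Phi> m + \<phi> m * (x - m) + \<phi>1 m / 2 * (x - m)\<^sup>2 + \<phi>2 t / 6 * (x - m) ^ 3"
    if "x \<in> {m - h, m + h}" for x
  proof -
    have "\<exists>t. (if x < m then x < t \<and> t < m else m < t \<and> t < x) \<and>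
       \<Phi> x = (\<Sum>i<3. D i m / fact i * (x - m) ^ i) + D 3 t / fact 3 * (x - m) ^ 3"
      by (rule Taylor[OF _ _ D]) (use h that in \<open>auto simp: D_def\<close>)
    then obtain t where t: "if x < m then x < t \<and> t < m else m < t \<and> t < x"
       "\<Phi> x = (\<Sum>i<3. D i m / fact i * (x - m) ^ i) + D 3 t / fact 3 * (x - m) ^ 3" by blast
    have "t \<in> {m - h..m + h}" using t(1) that h by (auto split: if_splits)
    moreover have "\<Phi> x = \<Phi> m + \<phi> m * (x - m) + \<phi>1 m / 2 * (x - m)\<^sup>2 + \<phi>2 t / 6 * (x - m) ^ 3"
      using t(2) by (simp add: D_def eval_nat_numeral)
    ultimately show ?thesis by blast
  qed
  obtain t1 where t1: "t1 \<in> {m - h..m + h}" "\<Phi> (m + h) = \<Phi> m + \<phi> m * h + \<phi>1 m / 2 * h\<^sup>2 + \<phi>2 t1 / 6 * h ^ 3"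
    using taylor[of "m + h"] by auto
  obtain t2 where t2: "t2 \<in> {m - h..m + h}" "\<Phi> (m - h) = \<Phi> m - \<phi> m * h + \<phi>1 m / 2 * h\<^sup>2 - \<phi>2 t2 / 6 * h ^ 3"
    using taylor[of "m - h"] by auto
  have "\<Phi> (m + h) - \<Phi> (m - h) - 2 * h * \<phi> m = (\<phi>2 t1 + \<phi>2 t2) / 6 * h ^ 3"
    using t1(2) t2(2) by (simp add: algebra_simps)
  also have "\<bar>\<dots>\<bar> = \<bar>\<phi>2 t1 + \<phi>2 t2\<bar> / 6 * h ^ 3" using h by (simp add: abs_mult)
  also have "\<dots> \<le> B * h ^ 3"
    using h B[OF t1(1)] B[OF t2(1)] by (intro mult_right_mono) auto
  finally show ?thesis .
qed

text \<open>
  The midpoint rule compares \<open>(j + 1/2) powr (- s)\<close> with the increment of \<open>A\<close> over \<open>{j..j + 1}\<close>, up to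
  a multiple of \<open>j powr (- s - 2)\<close>. That bound is dominated by the increments of \<open>j powr (- s - 1)\<close>, so the
  errors beyond \<open>M\<close> telescope to \<open>M powr (- s - 1)\<close>.
\<close>

lemma half_integer_sum_rate:
  fixes A :: "real \<Rightarrow> real"
  assumes s: "s > 0"
    and A: "\<And>y. y > 0 \<Longrightarrow> (A has_real_derivative y powr (- s)) (at y)"
    and L: "(\<lambda>M. (\<Sum>j<M. (real j + 1/2) powr (- s)) - A (real M)) \<longlonglongrightarrow> L"
  shows "\<exists>C. \<forall>M\<ge>1. \<bar>(\<Sum>j<M. (real j + 1/2) powr (- s)) - A (real M) - L\<bar> \<le> C * real M powr (- s - 1)"
proof -
  define e where "e M = (\<Sum>j<M. (real j + 1/2) powr (- s)) - A (real M)" for M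
  \<comment> \<open>The power of two pays for replacing \<open>j\<close> by \<open>(j + 1) / 2 \<le> j\<close>.\<close>
  define C where "C = s * 2 powr (s + 2)"
  have one_step: "\<bar>e (Suc j) - e j\<bar> \<le> C * (real j powr (- s - 1) - real (Suc j) powr (- s - 1))" if j: "j \<ge> 1" for j
  proof -
    have "\<bar>A (real j + 1/2 + 1/2) - A (real j + 1/2 - 1/2) - 2 * (1/2) * (real j + 1/2) powr (- s)\<bar>
        \<le> (s * (s + 1) * real j powr (- s - 2)) * (1/2) ^ 3"
    proof (rule midpoint_rule_error)
      fix t assume t: "t \<in> {real j + 1/2 - 1/2..real j + 1/2 + 1/2}"
      hence t': "t > 0" "t \<ge> real j" using j by auto
      show "(A has_real_derivative t powr (- s)) (at t)" using A t' by simp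
      show "((\<lambda>y. y powr (- s)) has_real_derivative - s * t powr (- s - 1)) (at t)"
        using t' by (auto intro!: derivative_eq_intros)
      show "((\<lambda>y. - s * y powr (- s - 1)) has_real_derivative - s * ((- s - 1) * t powr (- s - 2))) (at t)"
      proof -
        have e: "- s - 1 - 1 = - s - 2" by simp
        show ?thesis
          using DERIV_cmult[OF has_real_derivative_powr[OF t'(1), of "- s - 1"], of "- s"] unfolding e .
      qed
      have "\<bar>- s * ((- s - 1) * t powr (- s - 2))\<bar> = s * (s + 1) * t powr (- s - 2)"
        using s by (simp add: abs_mult)
      also have "\<dots> \<le> s * (s + 1) * real j powr (- s - 2)"
        using s t' j by (intro mult_left_mono powr_mono2') auto
      finally show "\<bar>- s * ((- s - 1) * t powr (- s - 2))\<bar> \<le> s * (s + 1) * real j powr (- s - 2)" .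
    qed simp
    hence "\<bar>e (Suc j) - e j\<bar> \<le> s * (s + 1) * real j powr (- s - 2) * (1/2) ^ 3"
      unfolding e_def by (simp add: algebra_simps abs_minus_commute)
    also have "\<dots> \<le> s * (s + 1) * real j powr (- s - 2)"
      by (rule mult_left_le) (use s in \<open>auto simp: power3_eq_cube\<close>)
    also have "real j powr (- s - 2) \<le> (real (Suc j) / 2) powr (- s - 2)"
      using s j by (intro powr_mono2') auto
    also have "(real (Suc j) / 2) powr (- s - 2) = 2 powr (s + 2) * real (Suc j) powr (- s - 2)"
    proof -
      have "- s - 2 = - (s + 2)" by simp
      hence "(2::real) powr (- s - 2) = 1 / 2 powr (s + 2)" by (simp only: powr_minus_divide)
      thus ?thesis by (simp only: powr_divide) simp
    qed
    also have "s * (s + 1) * (2 powr (s + 2) * real (Suc j) powr (- s - 2))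
       = C * ((s + 1) * real (Suc j) powr (- (s + 1) - 1) * (real (Suc j) - real j))"
    proof -
      have "- (s + 1) - 1 = - s - 2" by simp
      hence "real (Suc j) powr (- (s + 1) - 1) = real (Suc j) powr (- s - 2)" by (simp only:)
      thus ?thesis unfolding C_def by (simp only:) (simp add: algebra_simps)
    qed
    also have "\<dots> \<le> C * (real j powr (- (s + 1)) - real (Suc j) powr (- (s + 1)))"
      using s j by (intro mult_left_mono powr_neg_mean_value(2)) (auto simp: C_def)
    also have "- (s + 1) = - s - 1" by simp
    finally show ?thesis using s by simp
  qed
  have tail: "\<bar>e M' - e M\<bar> \<le> C * real M powr (- s - 1)" if "1 \<le> M" "M \<le> M'" for M M'
  proof -
    have "\<bar>e M' - e M\<bar> \<le> C * (real M powr (- s - 1) - real M' powr (- s - 1))"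
      using that(2)
    proof (induction M' rule: dec_induct)
      case (step n)
      have "\<bar>e (Suc n) - e M\<bar> \<le> \<bar>e (Suc n) - e n\<bar> + \<bar>e n - e M\<bar>" by linarith
      also have "\<dots> \<le> C * (real n powr (- s - 1) - real (Suc n) powr (- s - 1)) + C * (real M powr (- s - 1) - real n powr (- s - 1))"
        using step.IH step.hyps that by (intro add_mono one_step) auto
      finally show ?case by (simp add: algebra_simps)
    qed simp
    also have "\<dots> \<le> C * real M powr (- s - 1)"
      using s by (intro mult_left_mono) (auto simp: C_def)
    finally show ?thesis .
  qed
  have "\<bar>e M - L\<bar> \<le> C * real M powr (- s - 1)" if "1 \<le> M" for M
  proof (rule tendsto_upperbound)
    show "(\<lambda>M'. \<bar>e M - e M'\<bar>) \<longlonglongrightarrow> \<bar>e M - L\<bar>"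
      using L unfolding e_def[symmetric] by (intro tendsto_intros)
    show "\<forall>\<^sub>F M' in sequentially. \<bar>e M - e M'\<bar> \<le> C * real M powr (- s - 1)"
      using tail[OF that] by (auto simp: eventually_sequentially abs_minus_commute)
  qed simp
  thus ?thesis unfolding e_def by blast
qed

text \<open>
  The second derivative is free of cosines after \<open>cos\<^sup>2 = 1 - sin\<^sup>2\<close>. In this form its leading part
  is the kernel with exponent \<open>s + 2\<close>, which can be compared with the second derivative of \<open>t powr (- s)\<close>.
\<close>

lemma circle_kernel_deriv:
  assumes "0 < t" "t < 2 * pi"
  shows "(circle_kernel s has_real_derivative - s * circle_kernel (s + 1) t * cos (t / 2)) (at t)"
    and "((\<lambda>t. - s * circle_kernel (s + 1) t * cos (t / 2)) has_real_derivative
        s * (s + 1) * circle_kernel (s + 2) t - s\<^sup>2 / 4 * circle_kernel s t) (at t)"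
proof -
  have pos: "sin (t / 2) > 0" using assms by (intro sin_gt_zero) auto
  have deriv: "(circle_kernel p has_real_derivative - p * circle_kernel (p + 1) t * cos (t / 2)) (at t)" for p
  proof -
    have 1: "((\<lambda>t. 2 * sin (t / 2)) has_real_derivative cos (t / 2)) (at t)"
      by (auto intro!: derivative_eq_intros)
    have 2: "((\<lambda>x. x powr - p) has_real_derivative - p * (2 * sin (t / 2)) powr (- p - 1)) (at (2 * sin (t / 2)))"
      by (rule has_real_derivative_powr) (use pos in simp)
    have e: "- p - 1 = - (p + 1)" by simp
    show ?thesis using DERIV_chain2[OF 2 1] unfolding circle_kernel_def[abs_def] e .
  qed
  show "(circle_kernel s has_real_derivative - s * circle_kernel (s + 1) t * cos (t / 2)) (at t)"
    by (rule deriv)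
  define \<sigma> c X where "\<sigma> = sin (t / 2)" and "c = cos (t / 2)" and "X = circle_kernel (s + 2) t"
  have S: "circle_kernel (s + 1) t = X * (2 * \<sigma>)" "circle_kernel s t = X * (2 * \<sigma>)\<^sup>2"
  proof -
    have "circle_kernel (s + 1) t = circle_kernel (s + 2) t * (2 * \<sigma>) powr 1"
    proof -
      have "- (s + 1) = - (s + 2) + 1" by simp
      thus ?thesis unfolding circle_kernel_def \<sigma>_def by (simp only: powr_add)
    qed
    thus "circle_kernel (s + 1) t = X * (2 * \<sigma>)" using pos by (simp add: X_def \<sigma>_def)
    have "circle_kernel s t = circle_kernel (s + 2) t * (2 * \<sigma>) powr 2"
    proof -
      have "- s = - (s + 2) + 2" by simp
      thus ?thesis unfolding circle_kernel_def \<sigma>_def by (metis powr_add)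
    qed
    thus "circle_kernel s t = X * (2 * \<sigma>)\<^sup>2" using pos by (simp add: X_def \<sigma>_def powr_numeral)
  qed
  have "((\<lambda>t. - s * circle_kernel (s + 1) t * cos (t / 2)) has_real_derivative
      - s * (- (s + 1) * X * c) * c + (- s * circle_kernel (s + 1) t) * (- \<sigma> / 2)) (at t)"
  proof -
    have 1: "(circle_kernel (s + 1) has_real_derivative - (s + 1) * X * c) (at t)"
      using deriv[of "s + 1"] by (simp add: X_def c_def add.assoc)
    have 2: "((\<lambda>t. cos (t / 2)) has_real_derivative - \<sigma> / 2) (at t)"
      unfolding \<sigma>_def by (auto intro!: derivative_eq_intros)
    show ?thesis
      by (rule DERIV_cong[OF DERIV_mult[OF DERIV_cmult[OF 1] 2]]) (simp add: c_def algebra_simps)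
  qed
  also have "- s * (- (s + 1) * X * c) * c + (- s * circle_kernel (s + 1) t) * (- \<sigma> / 2)
      = s * (s + 1) * X * c\<^sup>2 + s * X * \<sigma>\<^sup>2"
    unfolding S by (simp add: power2_eq_square algebra_simps)
  also have "c\<^sup>2 = 1 - \<sigma>\<^sup>2" unfolding c_def \<sigma>_def by (rule cos_squared_eq)
  also have "s * (s + 1) * X * (1 - \<sigma>\<^sup>2) + s * X * \<sigma>\<^sup>2 = s * (s + 1) * X - s\<^sup>2 / 4 * circle_kernel s t"
    unfolding S by (simp add: power2_eq_square algebra_simps)
  finally show "((\<lambda>t. - s * circle_kernel (s + 1) t * cos (t / 2)) has_real_derivative
        s * (s + 1) * circle_kernel (s + 2) t - s\<^sup>2 / 4 * circle_kernel s t) (at t)"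
    unfolding X_def .
qed

text \<open>
  The kernel of the chord minus that of the arc. The arc contributes a Dirichlet series to sums over
  equally spaced points, and the defect contributes a Riemann sum.
\<close>

definition kernel_defect :: "real \<Rightarrow> real \<Rightarrow> real" where
  "kernel_defect s t = circle_kernel s t - t powr (- s)"

lemma kernel_defect_bound:
  assumes s: "0 < s" "s \<le> 1"
  shows "\<exists>K>0. \<forall>t. 0 < t \<longrightarrow> t \<le> pi \<longrightarrow> \<bar>kernel_defect s t\<bar> \<le> K * t"
proof -
  define K where "K = s * 2 powr (s + 1) * pi"
  have "\<bar>kernel_defect s t\<bar> \<le> K * t" if t: "0 < t" "t \<le> pi" for t
  proof -
    have "t powr (2 - s) = t * t powr (1 - s)"
      using t powr_add[of t 1 "1 - s"] by simp
    also have "t powr (1 - s) \<le> pi powr (1 - s)" using t s by (intro powr_mono2) auto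
    also have "pi powr (1 - s) \<le> pi powr 1" using s pi_gt3 by (intro powr_mono) auto
    finally have "t powr (2 - s) \<le> t * pi" using t by simp
    hence "s * 2 powr (s + 1) * t powr (2 - s) \<le> s * 2 powr (s + 1) * (t * pi)"
      using s by (intro mult_left_mono) auto
    hence "circle_kernel s t - t powr (- s) \<le> s * 2 powr (s + 1) * (t * pi)"
      using circle_kernel_minus_powr(2)[OF t, of s] s by linarith
    thus ?thesis using circle_kernel_minus_powr(1)[OF t, of s] s by (simp add: kernel_defect_def K_def mult_ac)
  qed
  moreover have "K > 0" using s by (simp add: K_def)
  ultimately show ?thesis by blast
qed

text \<open>
  The second derivative of the defect is of order \<open>t powr (- s)\<close>: the singularities of order \<open>s + 2\<close> of
  chord and arc cancel. On \<open>{0<..pi}\<close> it is dominated by \<open>1 / t\<close> since \<open>s \<le> 1\<close>.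
\<close>

lemma kernel_defect_deriv2_bound:
  assumes s: "0 < s" "s \<le> 1"
  shows "\<exists>K>0. \<forall>t. 0 < t \<longrightarrow> t \<le> pi \<longrightarrow>
     \<bar>s * (s + 1) * circle_kernel (s + 2) t - s\<^sup>2 / 4 * circle_kernel s t - s * (s + 1) * t powr (- s - 2)\<bar> \<le> K / t"
proof -
  define K where "K = s * (s + 1) * ((s + 2) * 2 powr (s + 3)) + s\<^sup>2 / 4 * 2 powr s"
  have K: "K > 0" using s by (auto simp: K_def intro!: add_pos_pos)
  have "\<bar>s * (s + 1) * circle_kernel (s + 2) t - s\<^sup>2 / 4 * circle_kernel s t - s * (s + 1) * t powr (- s - 2)\<bar> \<le> K * pi / t"
    if t: "0 < t" "t \<le> pi" for t
  proof -
    define a b where "a = circle_kernel (s + 2) t - t powr (- (s + 2))" and "b = circle_kernel s t"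
    have ab: "0 \<le> a" "a \<le> (s + 2) * 2 powr (s + 3) * t powr (- s)" "0 \<le> b" "b \<le> 2 powr s * t powr (- s)"
      using circle_kernel_minus_powr[OF t, of "s + 2"] circle_kernel_le[OF t, of s] s
      by (auto simp: a_def b_def circle_kernel_nonneg add.assoc)
    have "\<bar>s * (s + 1) * a - s\<^sup>2 / 4 * b\<bar> \<le> s * (s + 1) * a + s\<^sup>2 / 4 * b"
      using ab s by (intro order_trans[OF abs_triangle_ineq4]) auto
    also have "\<dots> \<le> s * (s + 1) * ((s + 2) * 2 powr (s + 3) * t powr (- s)) + s\<^sup>2 / 4 * (2 powr s * t powr (- s))"
      using ab s by (intro add_mono mult_left_mono) auto
    also have "\<dots> = K * t powr (- s)" by (simp add: K_def algebra_simps)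
    also have "t powr (- s) \<le> pi / t"
    proof -
      have "t powr (- s) = t powr (1 - s) / t" using t powr_diff[of t "1 - s" 1] by simp
      also have "t powr (1 - s) \<le> pi powr (1 - s)" using t s by (intro powr_mono2) auto
      also have "pi powr (1 - s) \<le> pi powr 1" using s pi_gt3 by (intro powr_mono) auto
      finally show ?thesis using t by (simp add: divide_right_mono)
    qed
    finally have "\<bar>s * (s + 1) * a - s\<^sup>2 / 4 * b\<bar> \<le> K * (pi / t)" using K by simp
    thus ?thesis by (simp add: a_def b_def algebra_simps)
  qed
  thus ?thesis using K by (intro exI[of _ "K * pi"]) auto
qed

lemma sum_inverse_le_sqrt: "(\<Sum>j\<in>{1..<M}. 1 / real j) \<le> 2 * sqrt (real M)"
proof -
  have "(\<Sum>j\<in>{1..M}. 1 / real j) \<le> 2 * sqrt (real M)" for M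
  proof (induction M)
    case (Suc M)
    define a b where "a = sqrt (real M)" and "b = sqrt (real (Suc M))"
    have ab: "b \<ge> 1" "b\<^sup>2 = a\<^sup>2 + 1" "b \<ge> a" "a \<ge> 0" by (auto simp: a_def b_def)
    have "1 = (b - a) * (b + a)" using ab by (simp add: power2_eq_square algebra_simps)
    also have "\<dots> \<le> (b - a) * (2 * b)" using ab by (intro mult_left_mono) auto
    also have "\<dots> \<le> (b - a) * (2 * b\<^sup>2)"
      using ab self_le_power[of b 2] by (intro mult_left_mono) auto
    finally have "1 \<le> (b - a) * (2 * b\<^sup>2)" .
    moreover have "0 < b\<^sup>2" using ab(1) by simp
    ultimately have "1 / b\<^sup>2 \<le> 2 * (b - a)" by (subst pos_divide_le_eq) (simp_all only: mult_ac)
    moreover have "b\<^sup>2 = real (Suc M)" by (simp add: b_def)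
    ultimately have "1 / real (Suc M) \<le> 2 * sqrt (real (Suc M)) - 2 * sqrt (real M)"
      by (simp add: a_def b_def)
    thus ?case using Suc by simp
  qed simp
  moreover have "(\<Sum>j\<in>{1..<M}. 1 / real j) \<le> (\<Sum>j\<in>{1..M}. 1 / real j)"
    by (intro sum_mono2) auto
  ultimately show ?thesis by (meson order_trans)
qed

text \<open>
  The midpoint rule for the defect on \<open>M\<close> cells of width \<open>pi / M\<close>. The second derivative is unbounded at
  \<open>0\<close>, so the first cell is estimated directly by the linear bound on the defect; on cell \<open>j \<ge> 1\<close> the second
  derivative is at most a multiple of \<open>M / j\<close>. The harmonic sum of these errors is bounded by the square
  root of \<open>M\<close>, which is crude, but all that matters is that after multiplication by \<open>M\<close> the error is a
  negative power of \<open>M\<close>, summable along powers of two.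
\<close>

lemma riemann_sum_kernel_defect:
  fixes \<Phi> :: "real \<Rightarrow> real"
  assumes s: "0 < s" "s \<le> 1"
    and d: "\<And>t. 0 < t \<Longrightarrow> t \<le> pi \<Longrightarrow> (\<Phi> has_real_derivative kernel_defect s t) (at t)"
    and lim: "(\<Phi> \<longlongrightarrow> \<Phi>0) (at_right 0)"
  shows "\<exists>C. \<forall>M\<ge>1. \<bar>\<Phi> pi - \<Phi>0 - pi / real M * (\<Sum>j<M. kernel_defect s ((real j + 1/2) * (pi / real M)))\<bar>
     \<le> C * sqrt (real M) / (real M)\<^sup>2"
proof -
  obtain K1 where K1: "K1 > 0" "\<And>t. 0 < t \<Longrightarrow> t \<le> pi \<Longrightarrow> \<bar>kernel_defect s t\<bar> \<le> K1 * t"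
    using kernel_defect_bound[OF s] by blast
  define \<phi>2 where "\<phi>2 t = s * (s + 1) * circle_kernel (s + 2) t - s\<^sup>2 / 4 * circle_kernel s t - s * (s + 1) * t powr (- s - 2)" for t
  obtain K2 where K2: "K2 > 0" "\<And>t. 0 < t \<Longrightarrow> t \<le> pi \<Longrightarrow> \<bar>\<phi>2 t\<bar> \<le> K2 / t"
    using kernel_defect_deriv2_bound[OF s] unfolding \<phi>2_def by blast
  define C where "C = (2 * K1 + 2 * K2) * pi\<^sup>2"
  show ?thesis
  proof (intro exI[of _ C] allI impI)
    fix M :: nat assume M: "M \<ge> 1"
    define w where "w = pi / real M"
    define f where "f j = w * kernel_defect s ((real j + 1/2) * w)" for j
    have w: "0 < w" "w \<le> pi" using M by (auto simp: w_def field_simps)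
    have Mw: "real M * w = pi" using M by (simp add: w_def)
    have first: "\<bar>\<Phi> w - \<Phi>0\<bar> \<le> K1 * w\<^sup>2"
    proof (rule tendsto_upperbound)
      show "((\<lambda>e. \<bar>\<Phi> w - \<Phi> e\<bar>) \<longlongrightarrow> \<bar>\<Phi> w - \<Phi>0\<bar>) (at_right 0)"
        by (intro tendsto_intros lim)
      show "\<forall>\<^sub>F e in at_right 0. \<bar>\<Phi> w - \<Phi> e\<bar> \<le> K1 * w\<^sup>2"
      proof (rule eventually_at_rightI[of 0 w])
        fix e assume e: "e \<in> {0<..<w}"
        have "\<exists>z. e < z \<and> z < w \<and> \<Phi> w - \<Phi> e = (w - e) * kernel_defect s z"
          by (rule MVT2) (use e w d in auto)
        then obtain z where z: "e < z" "z < w" "\<Phi> w - \<Phi> e = (w - e) * kernel_defect s z" by blast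
        have "\<bar>\<Phi> w - \<Phi> e\<bar> = (w - e) * \<bar>kernel_defect s z\<bar>" using z e by (simp add: abs_mult)
        also have "\<dots> \<le> w * (K1 * w)"
        proof (intro mult_mono)
          have "\<bar>kernel_defect s z\<bar> \<le> K1 * z" using z e w by (intro K1) auto
          also have "\<dots> \<le> K1 * w" using z K1 by simp
          finally show "\<bar>kernel_defect s z\<bar> \<le> K1 * w" .
        qed (use e w in auto)
        finally show "\<bar>\<Phi> w - \<Phi> e\<bar> \<le> K1 * w\<^sup>2" by (simp add: power2_eq_square mult_ac)
      qed (use w in auto)
    qed simp
    have f0: "\<bar>f 0\<bar> \<le> K1 * w\<^sup>2"
    proof -
      have "\<bar>f 0\<bar> = w * \<bar>kernel_defect s (w / 2)\<bar>" using w by (simp add: f_def abs_mult)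
      also have "\<dots> \<le> w * (K1 * w)"
      proof (intro mult_left_mono)
        have "\<bar>kernel_defect s (w / 2)\<bar> \<le> K1 * (w / 2)" using w by (intro K1) auto
        also have "\<dots> \<le> K1 * w" using K1 w by simp
        finally show "\<bar>kernel_defect s (w / 2)\<bar> \<le> K1 * w" .
      qed (use w in auto)
      finally show ?thesis by (simp add: power2_eq_square mult_ac)
    qed
    have cell: "\<bar>\<Phi> (real (Suc j) * w) - \<Phi> (real j * w) - f j\<bar> \<le> K2 * w\<^sup>2 * (1 / real j)" if j: "j \<in> {1..<M}" for j
    proof -
      define m where "m = (real j + 1/2) * w"
      have m: "m - w / 2 = real j * w" "m + w / 2 = real (Suc j) * w" by (auto simp: m_def algebra_simps)
      have "real j * w > 0" using j w by auto
      have "real (Suc j) \<le> real M" using j by auto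
      hence "real (Suc j) * w \<le> real M * w" using w by (intro mult_right_mono) auto
      hence "real (Suc j) * w \<le> pi" using Mw by simp
      have "\<bar>\<Phi> (m + w / 2) - \<Phi> (m - w / 2) - 2 * (w / 2) * kernel_defect s m\<bar> \<le> (K2 / (real j * w)) * (w / 2) ^ 3"
      proof (rule midpoint_rule_error)
        fix t assume "t \<in> {m - w / 2..m + w / 2}"
        hence t: "0 < t" "real j * w \<le> t" "t \<le> pi"
          using \<open>real j * w > 0\<close> \<open>real (Suc j) * w \<le> pi\<close> unfolding m by auto
        have t2: "t < 2 * pi" using t pi_gt_zero by linarith
        show "(\<Phi> has_real_derivative kernel_defect s t) (at t)" using d t by blast
        have e: "- s - 1 - 1 = - s - 2" by simp
        show "(kernel_defect s has_real_derivative
            - s * circle_kernel (s + 1) t * cos (t / 2) - - s * t powr (- s - 1)) (at t)"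
          unfolding kernel_defect_def[abs_def]
          by (intro DERIV_diff circle_kernel_deriv has_real_derivative_powr t t2)
        have "((\<lambda>t. - s * circle_kernel (s + 1) t * cos (t / 2) - - s * t powr (- s - 1)) has_real_derivative
            (s * (s + 1) * circle_kernel (s + 2) t - s\<^sup>2 / 4 * circle_kernel s t) - - s * ((- s - 1) * t powr (- s - 1 - 1))) (at t)"
          by (intro DERIV_diff DERIV_cmult circle_kernel_deriv has_real_derivative_powr t t2)
        also have "(s * (s + 1) * circle_kernel (s + 2) t - s\<^sup>2 / 4 * circle_kernel s t) - - s * ((- s - 1) * t powr (- s - 1 - 1)) = \<phi>2 t"
          unfolding e by (simp add: \<phi>2_def algebra_simps)
        finally show "((\<lambda>t. - s * circle_kernel (s + 1) t * cos (t / 2) - - s * t powr (- s - 1)) has_real_derivative \<phi>2 t) (at t)" .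
        have "\<bar>\<phi>2 t\<bar> \<le> K2 / t" using t by (intro K2) auto
        also have "\<dots> \<le> K2 / (real j * w)" using t K2 \<open>real j * w > 0\<close> by (intro divide_left_mono) auto
        finally show "\<bar>\<phi>2 t\<bar> \<le> K2 / (real j * w)" .
      qed (use w in auto)
      also have "(K2 / (real j * w)) * (w / 2) ^ 3 = (K2 * w\<^sup>2 * (1 / real j)) / 8"
        using w j by (simp add: power3_eq_cube power2_eq_square field_simps)
      also have "\<dots> \<le> K2 * w\<^sup>2 * (1 / real j)"
      proof -
        have "0 \<le> K2 * w\<^sup>2 * (1 / real j)" using K2 by simp
        moreover have "x / 8 \<le> x" if "0 \<le> x" for x :: real using that by simp
        ultimately show ?thesis by blast
      qed
      finally show ?thesis unfolding m by (simp add: f_def m_def)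
    qed
    have "\<Phi> pi - \<Phi> w = (\<Sum>j\<in>{1..<M}. \<Phi> (real (Suc j) * w) - \<Phi> (real j * w))"
      using sum_Suc_diff'[OF M, of "\<lambda>j. \<Phi> (real j * w)"] Mw by simp
    moreover have "(\<Sum>j<M. f j) = f 0 + (\<Sum>j\<in>{1..<M}. f j)"
      using M by (simp add: lessThan_atLeast0 sum.atLeast_Suc_lessThan)
    ultimately have "\<Phi> pi - \<Phi>0 - (\<Sum>j<M. f j) = (\<Phi> w - \<Phi>0) - f 0
         + (\<Sum>j\<in>{1..<M}. \<Phi> (real (Suc j) * w) - \<Phi> (real j * w) - f j)"
      by (simp add: sum_subtractf)
    also have "\<bar>\<dots>\<bar> \<le> \<bar>\<Phi> w - \<Phi>0\<bar> + \<bar>f 0\<bar> + (\<Sum>j\<in>{1..<M}. \<bar>\<Phi> (real (Suc j) * w) - \<Phi> (real j * w) - f j\<bar>)"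
      using sum_abs[of "\<lambda>j. \<Phi> (real (Suc j) * w) - \<Phi> (real j * w) - f j" "{1..<M}"] by linarith
    also have "\<dots> \<le> K1 * w\<^sup>2 + K1 * w\<^sup>2 + (\<Sum>j\<in>{1..<M}. K2 * w\<^sup>2 * (1 / real j))"
      by (intro add_mono first f0 sum_mono cell)
    also have "(\<Sum>j\<in>{1..<M}. K2 * w\<^sup>2 * (1 / real j)) \<le> K2 * w\<^sup>2 * (2 * sqrt (real M))"
      unfolding sum_distrib_left[symmetric] using K2 sum_inverse_le_sqrt[of M] by (intro mult_left_mono) auto
    also have "K1 * w\<^sup>2 + K1 * w\<^sup>2 \<le> 2 * K1 * w\<^sup>2 * sqrt (real M)"
      using mult_left_mono[of 1 "sqrt (real M)" "2 * K1 * w\<^sup>2"] K1 M by simp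
    finally have "\<bar>\<Phi> pi - \<Phi>0 - (\<Sum>j<M. f j)\<bar> \<le> 2 * K1 * w\<^sup>2 * sqrt (real M) + K2 * w\<^sup>2 * (2 * sqrt (real M))"
      by simp
    also have "\<dots> = C * sqrt (real M) / (real M)\<^sup>2"
      by (simp add: C_def w_def power_divide algebra_simps add_divide_distrib)
    finally show "\<bar>\<Phi> pi - \<Phi>0 - pi / real M * (\<Sum>j<M. kernel_defect s ((real j + 1/2) * (pi / real M)))\<bar>
        \<le> C * sqrt (real M) / (real M)\<^sup>2"
      by (simp add: f_def w_def sum_distrib_left)
  qed
qed

section \<open>Asymptotics of midpoint potentials\<close>

lemma sum_lessThan_add:
  fixes f :: "nat \<Rightarrow> 'a :: comm_monoid_add"
  shows "(\<Sum>j<m + n. f j) = (\<Sum>j<m. f j) + (\<Sum>j<n. f (m + j))"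
  by (induction n) (auto simp: add.assoc)

text \<open>
  The midpoints of an even number of cells come in pairs with equal kernel values, so only the half
  circle \<open>{0..pi}\<close> matters, where arc length measures the distance to a single singularity.
\<close>

lemma midpoint_potential_double:
  assumes M: "M \<ge> 1"
  shows "midpoint_potential (2 * M) s = 2 * (\<Sum>j<M. kernel_defect s ((real j + 1/2) * (pi / real M)))
     + 2 * (real M / pi) powr s * (\<Sum>j<M. (real j + 1/2) powr (- s))"
proof -
  define f where "f j = circle_kernel s ((2 * real j + 1) * pi / real (2 * M))" for j
  have arg: "(2 * real j + 1) * pi / real (2 * M) = (real j + 1/2) * (pi / real M)" for j
    using M by (simp add: field_simps)
  have "midpoint_potential (2 * M) s = (\<Sum>j<M. f j) + (\<Sum>j<M. f (M + j))"
    unfolding midpoint_potential_def mult_2 sum_lessThan_add f_def ..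
  also have "(\<Sum>j<M. f (M + j)) = (\<Sum>j<M. f (M - Suc j))"
  proof (intro sum.cong refl)
    fix j assume j: "j \<in> {..<M}"
    have "(2 * real (M - Suc j) + 1) * pi / real (2 * M) = 2 * pi - (2 * real (M + j) + 1) * pi / real (2 * M)"
      using j M by (simp add: of_nat_diff field_simps)
    thus "f (M + j) = f (M - Suc j)" unfolding f_def by (simp only: circle_kernel_reflect)
  qed
  also have "\<dots> = (\<Sum>j<M. f j)" by (rule sum.nat_diff_reindex)
  also have "(\<Sum>j<M. f j) = (\<Sum>j<M. kernel_defect s ((real j + 1/2) * (pi / real M)) + (real M / pi) powr s * (real j + 1/2) powr (- s))"
  proof (intro sum.cong refl)
    fix j
    have "(pi / real M) powr (- s) = (real M / pi) powr s"
      using M by (simp add: powr_minus powr_divide)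
    thus "f j = kernel_defect s ((real j + 1/2) * (pi / real M)) + (real M / pi) powr s * (real j + 1/2) powr (- s)"
      unfolding f_def arg kernel_defect_def powr_mult by simp
  qed
  finally show ?thesis by (simp add: sum.distrib sum_distrib_left algebra_simps)
qed

text \<open>
  The common part of the cases \<open>s < 1\<close> and \<open>s = 1\<close>, which differ only in the antiderivatives \<open>\<Phi>\<close> of the
  defect and \<open>A\<close> of \<open>y powr (- s)\<close>.
\<close>

lemma midpoint_potential_asymp:
  fixes \<Phi> A :: "real \<Rightarrow> real"
  assumes s: "0 < s" "s \<le> 1"
    and d: "\<And>t. 0 < t \<Longrightarrow> t \<le> pi \<Longrightarrow> (\<Phi> has_real_derivative kernel_defect s t) (at t)"
    and lim: "(\<Phi> \<longlongrightarrow> \<Phi>0) (at_right 0)"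
    and A: "\<And>y. y > 0 \<Longrightarrow> (A has_real_derivative y powr (- s)) (at y)"
    and L: "(\<lambda>M. (\<Sum>j<M. (real j + 1/2) powr (- s)) - A (real M)) \<longlonglongrightarrow> L"
  shows "\<exists>C. \<forall>M\<ge>1. \<bar>midpoint_potential (2 * M) s
     - (2 * (real M / pi) * (\<Phi> pi - \<Phi>0) + 2 * (real M / pi) powr s * (A (real M) + L))\<bar> \<le> C / sqrt (real M)"
proof -
  obtain C1 where C1: "\<And>M. M \<ge> 1 \<Longrightarrow> \<bar>\<Phi> pi - \<Phi>0 - pi / real M * (\<Sum>j<M. kernel_defect s ((real j + 1/2) * (pi / real M)))\<bar>
     \<le> C1 * sqrt (real M) / (real M)\<^sup>2"
    using riemann_sum_kernel_defect[OF s d lim] by blast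
  obtain C2 where C2: "\<And>M. M \<ge> 1 \<Longrightarrow> \<bar>(\<Sum>j<M. (real j + 1/2) powr (- s)) - A (real M) - L\<bar> \<le> C2 * real M powr (- s - 1)"
    using half_integer_sum_rate[OF s(1) A L] by blast
  show ?thesis
  proof (intro exI[of _ "2 * C1 / pi + 2 * C2"] allI impI)
    fix M :: nat assume M: "M \<ge> 1"
    define X where "X = (\<Sum>j<M. kernel_defect s ((real j + 1/2) * (pi / real M)))"
    define Y where "Y = (\<Sum>j<M. (real j + 1/2) powr (- s))"
    define m where "m = real M"
    define q where "q = sqrt m"
    have m: "m \<ge> 1" "q \<ge> 1" "m = q\<^sup>2" using M by (auto simp: m_def q_def)
    have "C2 \<ge> 0" using C2[of 1] by simp
    have 1: "\<bar>2 * X - 2 * (m / pi) * (\<Phi> pi - \<Phi>0)\<bar> \<le> 2 * C1 / pi / q"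
    proof -
      have "2 * X - 2 * (m / pi) * (\<Phi> pi - \<Phi>0) = - (2 * (m / pi)) * (\<Phi> pi - \<Phi>0 - pi / m * X)"
        using m by (simp add: field_simps)
      also have "\<bar>\<dots>\<bar> = 2 * (m / pi) * \<bar>\<Phi> pi - \<Phi>0 - pi / m * X\<bar>"
        using m by (simp add: abs_mult)
      also have "\<dots> \<le> 2 * (m / pi) * (C1 * q / m\<^sup>2)"
        using C1[OF M] m by (intro mult_left_mono) (auto simp: X_def m_def q_def)
      also have "\<dots> = 2 * C1 / pi / q" using m(2) unfolding m(3) by (simp add: field_simps power2_eq_square)
      finally show ?thesis .
    qed
    have 2: "\<bar>2 * (m / pi) powr s * Y - 2 * (m / pi) powr s * (A m + L)\<bar> \<le> 2 * C2 / q"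
    proof -
      have "2 * (m / pi) powr s * Y - 2 * (m / pi) powr s * (A m + L) = 2 * (m / pi) powr s * (Y - A m - L)"
        by (simp add: algebra_simps)
      also have "\<bar>\<dots>\<bar> = 2 * (m / pi) powr s * \<bar>Y - A m - L\<bar>" by (simp add: abs_mult)
      also have "\<dots> \<le> 2 * m powr s * (C2 * m powr (- s - 1))"
      proof (intro mult_mono)
        have "m / pi \<le> m" using m pi_gt3 by (simp add: field_simps)
        thus "(m / pi) powr s \<le> m powr s" using s m by (intro powr_mono2) auto
      qed (use C2[OF M] in \<open>auto simp: Y_def m_def\<close>)
      also have "\<dots> = 2 * C2 * (m powr s * m powr (- s - 1))" by simp
      also have "m powr s * m powr (- s - 1) = 1 / m"
        unfolding powr_add[symmetric] using m by (simp add: powr_minus_divide)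
      also have "2 * C2 * (1 / m) \<le> 2 * C2 * (1 / q)"
        using m \<open>C2 \<ge> 0\<close> self_le_power[of q 2] by (intro mult_left_mono divide_left_mono) auto
      finally show ?thesis by simp
    qed
    have "midpoint_potential (2 * M) s - (2 * (m / pi) * (\<Phi> pi - \<Phi>0) + 2 * (m / pi) powr s * (A m + L))
       = (2 * X - 2 * (m / pi) * (\<Phi> pi - \<Phi>0)) + (2 * (m / pi) powr s * Y - 2 * (m / pi) powr s * (A m + L))"
      using midpoint_potential_double[OF M, of s] by (simp add: X_def Y_def m_def)
    also have "\<bar>\<dots>\<bar> \<le> 2 * C1 / pi / q + 2 * C2 / q" using 1 2 by linarith
    finally show "\<bar>midpoint_potential (2 * M) s
     - (2 * (real M / pi) * (\<Phi> pi - \<Phi>0) + 2 * (real M / pi) powr s * (A (real M) + L))\<bar> \<le> (2 * C1 / pi + 2 * C2) / sqrt (real M)"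
      by (simp add: m_def q_def add_divide_distrib)
  qed
qed

lemma powr_antiderivative:
  assumes "s \<noteq> 1" "y > 0"
  shows "((\<lambda>y. y powr (1 - s) / (1 - s)) has_real_derivative y powr (- s)) (at y)"
proof -
  have "((\<lambda>y. y powr (1 - s) / (1 - s)) has_real_derivative ((1 - s) * y powr (1 - s - 1)) / (1 - s)) (at y)"
    by (intro DERIV_cdivide has_real_derivative_powr assms)
  thus ?thesis using assms by simp
qed

text \<open>
  Sums over the odd numbers are obtained from sums over all numbers up to \<open>2 * M\<close> by removing the even
  ones. This is the origin of the factor \<open>2 powr s - 1\<close>.
\<close>

lemma half_integer_sum_eq:
  "(\<Sum>j<M. (real j + 1/2) powr (- s)) = 2 powr s * (\<Sum>n<2 * M. real (Suc n) powr (- s)) - (\<Sum>n<M. real (Suc n) powr (- s))"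
proof (induction M)
  case (Suc M)
  have "(2 * x) powr (- s) * 2 powr s = x powr (- s)" for x :: real
    by (simp add: powr_mult powr_minus field_simps)
  from this[of "real M + 1/2"] this[of "real (Suc M)"]
  have "(real M + 1/2) powr (- s) = 2 powr s * real (Suc (2 * M)) powr (- s)"
       "real (Suc M) powr (- s) = 2 powr s * real (Suc (Suc (2 * M))) powr (- s)"
    by (auto simp: algebra_simps)
  thus ?case using Suc by (simp add: algebra_simps)
qed simp

text \<open>
  One formula for convergent and divergent series: for \<open>s > 1\<close> the subtracted term tends to \<open>0\<close>.
\<close>

lemma half_integer_sum_limit:
  assumes s: "s > 0" "s \<noteq> 1"
  shows "(\<lambda>M. (\<Sum>j<M. (real j + 1/2) powr (- s)) - real M powr (1 - s) / (1 - s))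
    \<longlonglongrightarrow> (2 powr s - 1) * Re (riemann_zeta (of_real s))"
proof -
  define Z where "Z M = (\<Sum>n<M. real (Suc n) powr (- s)) - real M powr (1 - s) / (1 - s)" for M
  define z where "z = Re (riemann_zeta (of_real s))"
  have Z: "Z \<longlonglongrightarrow> z"
  proof (cases "s < 1")
    case True
    have "(\<lambda>M. (real (Suc M) powr (1 - s) - real M powr (1 - s)) / (1 - s)) \<longlonglongrightarrow> 0"
      using s True by real_asymp
    from tendsto_add[OF riemann_zeta_real_limit[OF s(1) True] this] show ?thesis
      unfolding Z_def[abs_def] z_def by (simp add: diff_divide_distrib)
  next
    case False
    hence s1: "s > 1" using s by auto
    have "(\<lambda>M. real M powr (1 - s) / (1 - s)) \<longlonglongrightarrow> 0" using s1 by real_asymp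
    from tendsto_diff[OF riemann_zeta_real_sums[OF s1, unfolded sums_def] this] show ?thesis
      unfolding Z_def[abs_def] z_def by simp
  qed
  have "filterlim (\<lambda>M::nat. 2 * M) sequentially sequentially"
    by (intro filterlim_subseq) (auto simp: strict_mono_def)
  hence "(\<lambda>M. 2 powr s * Z (2 * M) - Z M) \<longlonglongrightarrow> 2 powr s * z - z"
    by (intro tendsto_intros Z filterlim_compose[OF Z])
  moreover have "2 powr s * Z (2 * M) - Z M = (\<Sum>j<M. (real j + 1/2) powr (- s)) - real M powr (1 - s) / (1 - s)" for M
  proof -
    have "2 powr s * (real (2 * M)) powr (1 - s) = 2 * real M powr (1 - s)"
      by (simp add: powr_mult powr_add[symmetric] flip: mult.assoc)
    hence "2 powr s * (real (2 * M) powr (1 - s) / (1 - s)) = real M powr (1 - s) / (1 - s) + real M powr (1 - s) / (1 - s)"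
      by (simp add: field_simps)
    thus ?thesis unfolding Z_def half_integer_sum_eq by (simp only: right_diff_distrib)
  qed
  ultimately have "(\<lambda>M. (\<Sum>j<M. (real j + 1/2) powr (- s)) - real M powr (1 - s) / (1 - s)) \<longlonglongrightarrow> 2 powr s * z - z"
    by (simp only:)
  thus ?thesis by (simp add: z_def left_diff_distrib)
qed

lemma half_integer_sum_limit_1:
  "(\<lambda>M. (\<Sum>j<M. (real j + 1/2) powr (- 1)) - ln (real M)) \<longlonglongrightarrow> euler_mascheroni + 2 * ln 2"
proof -
  have h: "(\<lambda>n. harm n - ln (real n)) \<longlonglongrightarrow> (euler_mascheroni :: real)"
    by (rule euler_mascheroni_LIMSEQ)
  have "filterlim (\<lambda>M::nat. 2 * M) sequentially sequentially"
    by (intro filterlim_subseq) (auto simp: strict_mono_def)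
  from filterlim_compose[OF h this]
  have h2: "(\<lambda>M. harm (2 * M) - ln (real (2 * M))) \<longlonglongrightarrow> (euler_mascheroni :: real)" .
  have "(\<lambda>M. 2 * (harm (2 * M) - ln (real (2 * M))) - (harm M - ln (real M)) + 2 * ln 2)
      \<longlonglongrightarrow> 2 * euler_mascheroni - euler_mascheroni + 2 * (ln 2 :: real)"
    by (intro tendsto_intros h h2)
  also have "2 * euler_mascheroni - euler_mascheroni + 2 * (ln 2 :: real) = euler_mascheroni + 2 * ln 2" by simp
  finally have lim: "(\<lambda>M. 2 * (harm (2 * M) - ln (real (2 * M))) - (harm M - ln (real M)) + 2 * ln 2)
      \<longlonglongrightarrow> euler_mascheroni + 2 * (ln 2 :: real)" .
  have ev: "\<forall>\<^sub>F M in sequentially. 2 * (harm (2 * M) - ln (real (2 * M))) - (harm M - ln (real M)) + 2 * ln 2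
     = (\<Sum>j<M. (real j + 1/2) powr (- 1)) - ln (real M)"
    using eventually_gt_at_top[of "0::nat"]
  proof eventually_elim
    case (elim M)
    have harm: "(\<Sum>n<k. real (Suc n) powr (- 1)) = harm k" for k
      unfolding harm_altdef by (simp add: powr_minus)
    have "ln (real (2 * M)) = ln 2 + ln (real M)" using elim by (simp add: ln_mult)
    thus ?case unfolding half_integer_sum_eq harm by simp
  qed
  show ?thesis using lim tendsto_cong[OF ev] by simp
qed

lemma continuous_on_kernel_defect:
  assumes s: "0 < s" "s \<le> 1"
  shows "continuous_on {0..4} (kernel_defect s)"
proof -
  have "continuous (at t within {0..4}) (kernel_defect s)" if t: "t \<in> {0..4}" for t
  proof (cases "t = 0")
    case True
    obtain K where K: "K > 0" "\<And>t. 0 < t \<Longrightarrow> t \<le> pi \<Longrightarrow> \<bar>kernel_defect s t\<bar> \<le> K * t"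
      using kernel_defect_bound[OF s] by blast
    have "(kernel_defect s \<longlongrightarrow> 0) (at 0 within {0..4})"
    proof (rule Lim_null_comparison)
      have "\<forall>\<^sub>F x in at 0 within {0..4}. x \<in> {0<..<pi}"
        unfolding eventually_at by (rule exI[of _ pi]) auto
      thus "\<forall>\<^sub>F x in at 0 within {0..4}. norm (kernel_defect s x) \<le> K * x"
        by eventually_elim (use K in auto)
      have "((\<lambda>x. K * x) \<longlongrightarrow> K * 0) (at 0 within {0..4})" by (intro tendsto_intros)
      thus "((\<lambda>x. K * x) \<longlongrightarrow> 0) (at 0 within {0..4})" by simp
    qed
    moreover have "kernel_defect s 0 = 0" by (simp add: kernel_defect_def circle_kernel_def)
    ultimately show ?thesis using True by (simp add: continuous_within)
  next
    case False
    hence "t > 0" "t < 2 * pi" using t pi_gt3 by auto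
    hence "(kernel_defect s has_real_derivative - s * circle_kernel (s + 1) t * cos (t / 2) - (- s * t powr (- s - 1))) (at t)"
      unfolding kernel_defect_def[abs_def]
      by (intro DERIV_diff circle_kernel_deriv has_real_derivative_powr)
    thus ?thesis using DERIV_isCont continuous_at_imp_continuous_at_within by blast
  qed
  thus ?thesis by (simp add: continuous_on_eq_continuous_within)
qed

lemma kernel_defect_antiderivative:
  fixes s :: real
  assumes s: "0 < s" "s < 1"
  defines "\<Phi> \<equiv> (\<lambda>x. integral {0..x} (kernel_defect s))"
  shows "\<And>t. 0 < t \<Longrightarrow> t \<le> pi \<Longrightarrow> (\<Phi> has_real_derivative kernel_defect s t) (at t)"
    and "(\<Phi> \<longlongrightarrow> 0) (at_right 0)"
proof -
  have cont: "continuous_on {0..4} (kernel_defect s)" by (rule continuous_on_kernel_defect) (use s in auto)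
  have deriv: "(\<Phi> has_real_derivative kernel_defect s t) (at t within {0..4})" if "t \<in> {0..4}" for t
    unfolding \<Phi>_def by (rule integral_has_real_derivative[OF cont that])
  show "(\<Phi> has_real_derivative kernel_defect s t) (at t)" if t: "0 < t" "t \<le> pi" for t
  proof -
    have "t < 4" using t pi_less_4 by linarith
    thus ?thesis using deriv[of t] t by (simp add: at_within_Icc_at)
  qed
  have "continuous (at 0 within {0..4}) \<Phi>" using deriv[of 0] DERIV_continuous by fastforce
  hence "(\<Phi> \<longlongrightarrow> \<Phi> 0) (at 0 within {0..4})" by (simp add: continuous_within)
  moreover have "\<Phi> 0 = 0" by (simp add: \<Phi>_def)
  ultimately show "(\<Phi> \<longlongrightarrow> 0) (at_right 0)" by (simp add: at_within_Icc_at_right)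
qed

lemma circle_kernel_has_integral:
  assumes s: "0 < s" "s < 1"
  shows "(circle_kernel s has_integral (integral {0..pi} (kernel_defect s) + pi powr (1 - s) / (1 - s))) {0..pi}"
proof -
  have "continuous_on {0..pi} (kernel_defect s)"
    by (rule continuous_on_subset[OF continuous_on_kernel_defect]) (use s pi_less_4 in auto)
  hence 1: "(kernel_defect s has_integral integral {0..pi} (kernel_defect s)) {0..pi}"
    by (intro integrable_integral integrable_continuous_real)
  have 2: "((\<lambda>t. t powr (- s)) has_integral pi powr (- s + 1) / (- s + 1)) {0..pi}"
    by (rule has_integral_powr_from_0) (use s in auto)
  show ?thesis using has_integral_add[OF 1 2] by (simp add: kernel_defect_def add.commute)
qed

text \<open>
  For \<open>s = 1\<close> the antiderivative is elementary, and its increment over \<open>{0..pi}\<close> supplies the part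
  \<open>ln (4 / pi)\<close> of the constant \<open>ln (8 / pi)\<close>.
\<close>

lemma kernel_defect_antiderivative_1:
  defines "\<Phi> \<equiv> (\<lambda>t. ln (tan (t / 4)) - ln t)"
  shows "\<And>t. 0 < t \<Longrightarrow> t \<le> pi \<Longrightarrow> (\<Phi> has_real_derivative kernel_defect 1 t) (at t)"
    and "(\<Phi> \<longlongrightarrow> - ln 4) (at_right 0)"
    and "\<Phi> pi = - ln pi"
proof -
  show "(\<Phi> has_real_derivative kernel_defect 1 t) (at t)" if t: "0 < t" "t \<le> pi" for t
  proof -
    have pos: "sin (t / 4) > 0" "cos (t / 4) > 0" using t by (auto intro!: sin_gt_zero cos_gt_zero)
    hence "tan (t / 4) > 0" by (simp add: tan_def)
    have "((\<lambda>t. t / 4) has_real_derivative 1 / 4) (at t)" by (auto intro!: derivative_eq_intros)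
    from DERIV_chain2[OF DERIV_tan this] pos
    have "((\<lambda>t. tan (t / 4)) has_real_derivative inverse ((cos (t / 4))\<^sup>2) * (1 / 4)) (at t)" by simp
    from DERIV_diff[OF DERIV_chain2[OF DERIV_ln[OF \<open>tan (t / 4) > 0\<close>] this] DERIV_ln[OF t(1)]]
    have "(\<Phi> has_real_derivative inverse (tan (t / 4)) * (inverse ((cos (t / 4))\<^sup>2) * (1 / 4)) - 1 / t) (at t)"
      unfolding \<Phi>_def inverse_eq_divide[of t] .
    also have "inverse (tan (t / 4)) * (inverse ((cos (t / 4))\<^sup>2) * (1 / 4)) = 1 / (2 * (2 * sin (t / 4) * cos (t / 4)))"
      using pos by (simp add: tan_def field_simps power2_eq_square)
    also have "2 * sin (t / 4) * cos (t / 4) = sin (t / 2)" using sin_double[of "t / 4"] by simp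
    also have "1 / (2 * sin (t / 2)) - 1 / t = kernel_defect 1 t"
    proof -
      have "t / 2 < pi" using t pi_gt_zero by linarith
      hence "sin (t / 2) > 0" using t by (intro sin_gt_zero) auto
      thus ?thesis using t by (simp add: kernel_defect_def circle_kernel_def powr_minus_divide)
    qed
    finally show ?thesis .
  qed
  show "(\<Phi> \<longlongrightarrow> - ln 4) (at_right 0)"
  proof -
    have "((\<lambda>t::real. tan (t / 4) / t) \<longlongrightarrow> 1 / 4) (at_right 0)" by real_asymp
    hence "((\<lambda>t::real. ln (tan (t / 4) / t)) \<longlongrightarrow> ln (1 / 4)) (at_right 0)"
      by (rule tendsto_ln) simp
    moreover have "\<forall>\<^sub>F t in at_right 0. ln (tan (t / 4) / t) = \<Phi> t"
    proof (rule eventually_at_rightI[of 0 1])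
      fix t :: real assume t: "t \<in> {0<..<1}"
      hence "t / 4 < pi / 2" using pi_gt3 by auto
      hence "tan (t / 4) > 0" using t by (intro tan_gt_zero) auto
      thus "ln (tan (t / 4) / t) = \<Phi> t" using t by (simp add: \<Phi>_def ln_div)
    qed simp
    ultimately have "(\<Phi> \<longlongrightarrow> ln (1 / 4)) (at_right 0)" by (rule Lim_transform_eventually)
    thus ?thesis by (simp add: ln_div)
  qed
  show "\<Phi> pi = - ln pi" by (simp add: \<Phi>_def tan_45)
qed

section \<open>The energy of arclength\<close>

lemma borel_measurable_circle_kernel [measurable]: "circle_kernel s \<in> borel_measurable borel"
proof -
  have [measurable]: "(\<lambda>t::real. 2 * sin (t / 2)) \<in> borel_measurable borel"
    by (intro borel_measurable_continuous_onI continuous_intros) auto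
  show ?thesis unfolding circle_kernel_def[abs_def] by measurable
qed

lemma borel_measurable_riesz_kernel:
  assumes "s > 0" and [measurable]: "f \<in> borel_measurable M" "g \<in> borel_measurable M"
  shows "(\<lambda>x. riesz_kernel s (f x) (g x)) \<in> borel_measurable M"
  unfolding riesz_kernel_eq_inverse[OF assms(1)] by measurable

lemma nn_integral_circle_kernel:
  assumes J: "(circle_kernel s has_integral J) {0..pi}"
  shows "(\<integral>\<^sup>+t. ennreal (circle_kernel s t) * indicator {0..2 * pi} t \<partial>lborel) = ennreal (2 * J)"
proof -
  have "J \<ge> 0" using J by (rule has_integral_nonneg) (simp add: circle_kernel_nonneg)
  have half: "(\<integral>\<^sup>+t. ennreal (circle_kernel s t) * indicator {0..pi} t \<partial>lborel) = ennreal J"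
  proof -
    have "((\<lambda>t. circle_kernel s t * indicator {0..pi} t) has_integral J) UNIV"
    proof -
      have "(\<lambda>t. circle_kernel s t * indicator {0..pi} t) = (\<lambda>t. if t \<in> {0..pi} then circle_kernel s t else 0)"
        by (auto simp: indicator_def)
      thus ?thesis using J by (simp only: has_integral_restrict_UNIV)
    qed
    from nn_integral_has_integral_lborel[OF _ _ this]
    have "(\<integral>\<^sup>+t. ennreal (circle_kernel s t * indicator {0..pi} t) \<partial>lborel) = ennreal J"
      by (simp add: circle_kernel_nonneg)
    thus ?thesis by (simp add: ennreal_mult' circle_kernel_nonneg ennreal_indicator)
  qed
  have "(\<integral>\<^sup>+t. ennreal (circle_kernel s t) * indicator {0..2 * pi} t \<partial>lborel)
     = (\<integral>\<^sup>+t. ennreal (circle_kernel s t) * indicator {0..pi} t + ennreal (circle_kernel s t) * indicator {pi..2 * pi} t \<partial>lborel)"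
    by (rule nn_integral_cong_AE) (use AE_lborel_singleton[of pi] in eventually_elim, auto simp: indicator_def)
  also have "\<dots> = ennreal J + (\<integral>\<^sup>+t. ennreal (circle_kernel s t) * indicator {pi..2 * pi} t \<partial>lborel)"
    by (subst nn_integral_add) (simp_all add: half)
  also have "(\<integral>\<^sup>+t. ennreal (circle_kernel s t) * indicator {pi..2 * pi} t \<partial>lborel)
     = (\<integral>\<^sup>+t. ennreal (circle_kernel s (2 * pi + (-1) * t)) * indicator {pi..2 * pi} (2 * pi + (-1) * t) \<partial>lborel)"
    by (subst nn_integral_real_affine[where c = "-1" and t = "2 * pi"]) simp_all
  also have "\<dots> = (\<integral>\<^sup>+t. ennreal (circle_kernel s t) * indicator {0..pi} t \<partial>lborel)"
  proof (intro nn_integral_cong)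
    fix t :: real
    have "2 * pi + (-1) * t \<in> {pi..2 * pi} \<longleftrightarrow> t \<in> {0..pi}" by auto
    moreover have "circle_kernel s (2 * pi + (-1) * t) = circle_kernel s t" using circle_kernel_reflect[of s t] by simp
    ultimately show "ennreal (circle_kernel s (2 * pi + (-1) * t)) * indicator {pi..2 * pi} (2 * pi + (-1) * t)
        = ennreal (circle_kernel s t) * indicator {0..pi} t" by (simp add: indicator_def)
  qed
  also note half
  also have "ennreal J + ennreal J = ennreal (2 * J)"
    using \<open>J \<ge> 0\<close> by (simp flip: ennreal_plus)
  finally show ?thesis .
qed

lemma riesz_kernel_commute: "riesz_kernel s x y = riesz_kernel s y x"
  by (simp add: riesz_kernel_def norm_minus_commute)

text \<open>
  Rotation invariance. Cutting \<open>{0..2 * pi}\<close> at \<open>u\<close>, the substitutions \<open>t \<mapsto> u - t\<close> and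
  \<open>t \<mapsto> u + 2 * pi - t\<close> map the two pieces onto \<open>{0..u}\<close> and \<open>{u..2 * pi}\<close>.
\<close>

lemma nn_integral_riesz_kernel_cis:
  assumes s: "s > 0" and u: "u \<in> {0..2 * pi}"
  shows "(\<integral>\<^sup>+t. riesz_kernel s (cis u) (cis t) * indicator {0..2 * pi} t \<partial>lborel)
     = (\<integral>\<^sup>+t. ennreal (circle_kernel s t) * indicator {0..2 * pi} t \<partial>lborel)"
proof -
  let ?k = "\<lambda>t. ennreal (circle_kernel s t)"
  have "(\<integral>\<^sup>+t. riesz_kernel s (cis u) (cis t) * indicator {0..2 * pi} t \<partial>lborel)
     = (\<integral>\<^sup>+t. ?k (u + (-1) * t) * indicator {0..u} (u + (-1) * t)
         + ?k (u + 2 * pi + (-1) * t) * indicator {u..2 * pi} (u + 2 * pi + (-1) * t) \<partial>lborel)"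
  proof (rule nn_integral_cong_AE)
    show "AE t in lborel. riesz_kernel s (cis u) (cis t) * indicator {0..2 * pi} t
       = ?k (u + (-1) * t) * indicator {0..u} (u + (-1) * t)
         + ?k (u + 2 * pi + (-1) * t) * indicator {u..2 * pi} (u + 2 * pi + (-1) * t)"
      using AE_lborel_singleton[of u] AE_lborel_singleton[of 0] AE_lborel_singleton[of "2 * pi"]
    proof eventually_elim
      case (elim t)
      consider "t < 0 \<or> t > 2 * pi" | "0 < t" "t < u" | "u < t" "t < 2 * pi" using elim by linarith
      thus ?case
      proof cases
        case 1
        thus ?thesis using u by (auto simp: indicator_def)
      next
        case 2
        have "riesz_kernel s (cis u) (cis t) = ?k (u - t)"
          by (rule riesz_kernel_cis) (use 2 u in auto)
        thus ?thesis using 2 u by (auto simp: indicator_def)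
      next
        case 3
        have "riesz_kernel s (cis t) (cis u) = ?k (t - u)"
          by (rule riesz_kernel_cis) (use 3 u in auto)
        also have "circle_kernel s (t - u) = circle_kernel s (2 * pi - (t - u))" by (rule circle_kernel_reflect[symmetric])
        also have "2 * pi - (t - u) = u + 2 * pi - t" by simp
        finally show ?thesis using 3 u by (auto simp: indicator_def riesz_kernel_commute[of s "cis u"])
      qed
    qed
  qed
  also have "\<dots> = (\<integral>\<^sup>+t. ?k (u + (-1) * t) * indicator {0..u} (u + (-1) * t) \<partial>lborel)
         + (\<integral>\<^sup>+t. ?k (u + 2 * pi + (-1) * t) * indicator {u..2 * pi} (u + 2 * pi + (-1) * t) \<partial>lborel)"
    by (rule nn_integral_add) measurable
  also have "(\<integral>\<^sup>+t. ?k (u + (-1) * t) * indicator {0..u} (u + (-1) * t) \<partial>lborel) = (\<integral>\<^sup>+t. ?k t * indicator {0..u} t \<partial>lborel)"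
    by (subst (2) nn_integral_real_affine[where c = "-1" and t = u]) simp_all
  also have "(\<integral>\<^sup>+t. ?k (u + 2 * pi + (-1) * t) * indicator {u..2 * pi} (u + 2 * pi + (-1) * t) \<partial>lborel)
     = (\<integral>\<^sup>+t. ?k t * indicator {u..2 * pi} t \<partial>lborel)"
    by (subst (2) nn_integral_real_affine[where c = "-1" and t = "u + 2 * pi"]) simp_all
  also have "(\<integral>\<^sup>+t. ?k t * indicator {0..u} t \<partial>lborel) + (\<integral>\<^sup>+t. ?k t * indicator {u..2 * pi} t \<partial>lborel)
     = (\<integral>\<^sup>+t. ?k t * indicator {0..u} t + ?k t * indicator {u..2 * pi} t \<partial>lborel)"
    by (rule nn_integral_add[symmetric]) measurable
  also have "\<dots> = (\<integral>\<^sup>+t. ?k t * indicator {0..2 * pi} t \<partial>lborel)"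
  proof (rule nn_integral_cong_AE)
    show "AE t in lborel. ?k t * indicator {0..u} t + ?k t * indicator {u..2 * pi} t = ?k t * indicator {0..2 * pi} t"
      using AE_lborel_singleton[of u] by eventually_elim (use u in \<open>auto simp: indicator_def\<close>)
  qed
  finally show ?thesis .
qed

lemma nn_integral_arclength_prob:
  assumes [measurable]: "f \<in> borel_measurable borel"
  shows "(\<integral>\<^sup>+x. f x \<partial>arclength_prob) = (\<integral>\<^sup>+t. f (cis t) * indicator {0..2 * pi} t \<partial>lborel) / ennreal (2 * pi)"
proof -
  have [measurable]: "cis \<in> borel_measurable borel"
    by (intro borel_measurable_continuous_onI continuous_intros)
  have "(\<integral>\<^sup>+x. f x \<partial>arclength_prob) = (\<integral>\<^sup>+t. f (cis t) \<partial>uniform_measure lborel {0..2 * pi})"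
    unfolding arclength_prob_def by (subst nn_integral_distr) auto
  thus ?thesis by (simp add: nn_integral_uniform_measure)
qed

text \<open>
  The potential of arclength is constant on the circle, so its average is its value at any point.
\<close>

lemma riesz_energy_arclength_prob:
  assumes s: "s > 0" and J: "(circle_kernel s has_integral J) {0..pi}"
  shows "riesz_energy s arclength_prob = ennreal (J / pi)"
proof -
  have "J \<ge> 0" using J by (rule has_integral_nonneg) (simp add: circle_kernel_nonneg)
  have cis[measurable]: "cis \<in> borel_measurable borel"
    by (intro borel_measurable_continuous_onI continuous_intros)
  have [measurable]: "sets arclength_prob = sets borel" by (simp add: arclength_prob_def)
  have W: "(\<integral>\<^sup>+y. riesz_kernel s (cis u) y \<partial>arclength_prob) = ennreal (J / pi)" if u: "u \<in> {0..2 * pi}" for u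
  proof -
    have "(\<integral>\<^sup>+y. riesz_kernel s (cis u) y \<partial>arclength_prob)
      = (\<integral>\<^sup>+t. riesz_kernel s (cis u) (cis t) * indicator {0..2 * pi} t \<partial>lborel) / ennreal (2 * pi)"
      by (intro nn_integral_arclength_prob borel_measurable_riesz_kernel s) auto
    also have "\<dots> = ennreal (2 * J) / ennreal (2 * pi)"
      unfolding nn_integral_riesz_kernel_cis[OF s u] nn_integral_circle_kernel[OF J] ..
    also have "\<dots> = ennreal (J / pi)" using \<open>J \<ge> 0\<close> by (subst divide_ennreal) auto
    finally show ?thesis .
  qed
  have "finite_measure arclength_prob"
  proof
    show "emeasure arclength_prob (space arclength_prob) \<noteq> \<infinity>"
      using nn_integral_arclength_prob[of "\<lambda>_. 1"] by (auto simp: divide_ennreal)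
  qed
  then interpret finite_measure arclength_prob .
  have meas: "(\<lambda>x. \<integral>\<^sup>+y. riesz_kernel s x y \<partial>arclength_prob) \<in> borel_measurable borel"
  proof (intro borel_measurable_nn_integral)
    have "snd \<in> borel_measurable (borel \<Otimes>\<^sub>M arclength_prob)"
      using measurable_snd[of borel arclength_prob] measurable_cong_sets[OF refl \<open>sets arclength_prob = sets borel\<close>] by auto
    thus "(\<lambda>(x, y). riesz_kernel s x y) \<in> borel_measurable (borel \<Otimes>\<^sub>M arclength_prob)"
      unfolding split_def by (intro borel_measurable_riesz_kernel s) auto
  qed
  have "riesz_energy s arclength_prob
     = (\<integral>\<^sup>+t. (\<integral>\<^sup>+y. riesz_kernel s (cis t) y \<partial>arclength_prob) * indicator {0..2 * pi} t \<partial>lborel) / ennreal (2 * pi)"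
    unfolding riesz_energy_def by (rule nn_integral_arclength_prob[OF meas])
  also have "(\<integral>\<^sup>+t. (\<integral>\<^sup>+y. riesz_kernel s (cis t) y \<partial>arclength_prob) * indicator {0..2 * pi} t \<partial>lborel)
     = (\<integral>\<^sup>+t. ennreal (J / pi) * indicator {0..2 * pi} t \<partial>lborel)"
    by (intro nn_integral_cong) (auto simp: indicator_def W)
  also have "\<dots> = ennreal (J / pi) * ennreal (2 * pi)"
    by (subst nn_integral_cmult_indicator) auto
  also have "\<dots> / ennreal (2 * pi) = ennreal (J / pi)"
    using \<open>J \<ge> 0\<close> by (simp add: ennreal_mult[symmetric] divide_ennreal)
  finally show ?thesis .
qed

section \<open>Asymptotics along powers of two\<close>

text \<open>
  The case \<open>n = 1\<close> is the only power of two that is not even, and is absorbed into the constant.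
\<close>

lemma dyadic_bound:
  fixes D g :: "nat \<Rightarrow> real"
  assumes "\<And>M. M \<ge> 1 \<Longrightarrow> \<bar>D (2 * M)\<bar> \<le> C * g (2 * M)" and "\<And>n. n \<ge> 1 \<Longrightarrow> g n > 0"
  shows "\<exists>C\<ge>0. \<forall>k. \<bar>D (2 ^ k)\<bar> \<le> C * g (2 ^ k)"
proof (intro exI[of _ "max C (\<bar>D 1\<bar> / g 1)"] conjI allI)
  have g1: "g 1 > 0" using assms(2) by simp
  show "max C (\<bar>D 1\<bar> / g 1) \<ge> 0" using g1 by (simp add: le_max_iff_disj)
  show "\<bar>D (2 ^ k)\<bar> \<le> max C (\<bar>D 1\<bar> / g 1) * g (2 ^ k)" for k
  proof (cases k)
    case 0
    have "\<bar>D 1\<bar> = \<bar>D 1\<bar> / g 1 * g 1" using g1 by simp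
    also have "\<dots> \<le> max C (\<bar>D 1\<bar> / g 1) * g 1" using g1 by (intro mult_right_mono) auto
    finally show ?thesis using 0 by simp
  next
    case (Suc i)
    have "\<bar>D (2 ^ k)\<bar> \<le> C * g (2 ^ k)" using assms(1)[of "2 ^ i"] Suc by simp
    also have "\<dots> \<le> max C (\<bar>D 1\<bar> / g 1) * g (2 ^ k)"
      using assms(2)[of "2 ^ k"] by (intro mult_right_mono) auto
    finally show ?thesis .
  qed
qed

definition zeta_coeff :: "real \<Rightarrow> real" where
  "zeta_coeff s = (2 powr s - 1) * (2 * Re (riemann_zeta (of_real s)) / (2 * pi) powr s)"

lemma zeta_coeff_double:
  "zeta_coeff s * real (2 * M) powr s = 2 * (real M / pi) powr s * ((2 powr s - 1) * Re (riemann_zeta (of_real s)))"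
proof -
  have "real (2 * M) powr s / (2 * pi) powr s = (real M / pi) powr s"
    by (simp add: powr_divide[symmetric])
  moreover have "c * (2 * R / Y) * X = 2 * (X / Y) * (c * R)" for c R X Y :: real by simp
  ultimately show ?thesis unfolding zeta_coeff_def by (simp only:)
qed

lemma inverse_sqrt_double: "C / sqrt (real M) = (C * sqrt 2) * (1 / sqrt (real (2 * M)))"
  by (simp add: real_sqrt_mult)

text \<open>
  The Riemann sum and the term \<open>M powr (1 - s) / (1 - s)\<close> of the Dirichlet sum are both linear in \<open>M\<close>;
  together they make up the integral of the kernel, that is, the energy of arclength.
\<close>

lemma midpoint_potential_dyadic_lt_1:
  assumes s: "0 < s" "s < 1" and J: "(circle_kernel s has_integral J) {0..pi}"
  shows "\<exists>C\<ge>0. \<forall>k. \<bar>midpoint_potential (2 ^ k) s - (real (2 ^ k) * (J / pi) + zeta_coeff s * real (2 ^ k) powr s)\<bar>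
     \<le> C * (1 / sqrt (real (2 ^ k)))"
proof -
  define I where "I = integral {0..pi} (kernel_defect s)"
  have J_eq: "J = I + pi powr (1 - s) / (1 - s)"
    using has_integral_unique[OF J circle_kernel_has_integral[OF s]] by (simp add: I_def)
  have "\<exists>C. \<forall>M\<ge>1. \<bar>midpoint_potential (2 * M) s
     - (2 * (real M / pi) * (integral {0..pi} (kernel_defect s) - 0) + 2 * (real M / pi) powr s
        * (real M powr (1 - s) / (1 - s) + (2 powr s - 1) * Re (riemann_zeta (of_real s))))\<bar> \<le> C / sqrt (real M)"
    by (rule midpoint_potential_asymp[OF _ _ kernel_defect_antiderivative powr_antiderivative half_integer_sum_limit])
       (use s in auto)
  then obtain C where C: "\<And>M. M \<ge> 1 \<Longrightarrow> \<bar>midpoint_potential (2 * M) s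
     - (2 * (real M / pi) * (I - 0) + 2 * (real M / pi) powr s
        * (real M powr (1 - s) / (1 - s) + (2 powr s - 1) * Re (riemann_zeta (of_real s))))\<bar> \<le> C / sqrt (real M)"
    unfolding I_def by blast
  show ?thesis
  proof (rule dyadic_bound)
    fix M :: nat assume M: "M \<ge> 1"
    have "(real M / pi) powr s * (real M powr (1 - s) / (1 - s)) = (real M / pi) * (pi powr (1 - s) / (1 - s))"
    proof -
      have "real M powr s * real M powr (1 - s) = real M"
        using M by (simp add: powr_add[symmetric])
      moreover have "pi powr s * pi powr (1 - s) = pi" by (simp add: powr_add[symmetric])
      moreover have "(a / c) * (b / e) = (a * b) / (c * d) * (d / e)" if "d \<noteq> 0" for a b c d e :: real
        using that by simp
      from this[of "pi powr (1 - s)" "real M powr s" "pi powr s" "real M powr (1 - s)" "1 - s"]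
      have "(real M powr s / pi powr s) * (real M powr (1 - s) / (1 - s))
          = (real M powr s * real M powr (1 - s)) / (pi powr s * pi powr (1 - s)) * (pi powr (1 - s) / (1 - s))"
        by simp
      ultimately show ?thesis by (simp only: powr_divide)
    qed
    moreover have "2 * m * (I - 0) + 2 * a * (e + l) = 2 * m * (I + f) + 2 * a * l"
      if "a * e = m * f" for a e f l m :: real
      using that by (simp add: algebra_simps)
    ultimately have "2 * (real M / pi) * (I - 0) + 2 * (real M / pi) powr s
        * (real M powr (1 - s) / (1 - s) + (2 powr s - 1) * Re (riemann_zeta (of_real s)))
       = 2 * (real M / pi) * J + zeta_coeff s * real (2 * M) powr s"
      unfolding zeta_coeff_double J_eq by blast
    also have "2 * (real M / pi) * J = real (2 * M) * (J / pi)" by simp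
    finally show "\<bar>midpoint_potential (2 * M) s - (real (2 * M) * (J / pi) + zeta_coeff s * real (2 * M) powr s)\<bar>
        \<le> C * sqrt 2 * (1 / sqrt (real (2 * M)))"
      using C[OF M] unfolding inverse_sqrt_double[of C M] by (simp only:)
  qed simp
qed

lemma midpoint_potential_dyadic_1:
  "\<exists>C\<ge>0. \<forall>k. \<bar>midpoint_potential (2 ^ k) 1 - real (2 ^ k) / pi * (ln (real (2 ^ k)) + euler_mascheroni + ln (8 / pi))\<bar>
     \<le> C * (1 / sqrt (real (2 ^ k)))"
proof -
  have "\<exists>C. \<forall>M\<ge>1. \<bar>midpoint_potential (2 * M) 1
     - (2 * (real M / pi) * ((ln (tan (pi / 4)) - ln pi) - (- ln 4)) + 2 * (real M / pi) powr 1
        * (ln (real M) + (euler_mascheroni + 2 * ln 2)))\<bar> \<le> C / sqrt (real M)"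
  proof (rule midpoint_potential_asymp)
    show "(ln has_real_derivative y powr - 1) (at y)" if "y > 0" for y :: real
      using that DERIV_ln[of y] by (simp add: powr_minus)
  qed (use kernel_defect_antiderivative_1 half_integer_sum_limit_1 in auto)
  then obtain C where C: "\<And>M. M \<ge> 1 \<Longrightarrow> \<bar>midpoint_potential (2 * M) 1
     - (2 * (real M / pi) * ((ln (tan (pi / 4)) - ln pi) - (- ln 4)) + 2 * (real M / pi) powr 1
        * (ln (real M) + (euler_mascheroni + 2 * ln 2)))\<bar> \<le> C / sqrt (real M)" by blast
  show ?thesis
  proof (rule dyadic_bound)
    fix M :: nat assume M: "M \<ge> 1"
    have l: "ln (4::real) = 2 * ln 2" "ln (8::real) = 3 * ln 2"
      using ln_realpow[of 2 2] ln_realpow[of 2 3] by simp_all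
    have "2 * (real M / pi) * ((ln (tan (pi / 4)) - ln pi) - (- ln 4)) + 2 * (real M / pi) powr 1
        * (ln (real M) + (euler_mascheroni + 2 * ln 2))
      = real (2 * M) / pi * (ln (real (2 * M)) + euler_mascheroni + ln (8 / pi))"
      using M by (simp add: tan_45 ln_mult ln_div l field_simps)
    thus "\<bar>midpoint_potential (2 * M) 1 - real (2 * M) / pi * (ln (real (2 * M)) + euler_mascheroni + ln (8 / pi))\<bar>
        \<le> C * sqrt 2 * (1 / sqrt (real (2 * M)))"
      using C[OF M] unfolding inverse_sqrt_double[of C M] by simp
  qed simp
qed

text \<open>
  For \<open>s = 2\<close> there is no error at all, and this is needed: even bounded errors for the binary digits
  could add up to the order of \<open>ln N\<close>. The identity \<open>1 / sin\<^sup>2 x + 1 / cos\<^sup>2 x = 4 / sin\<^sup>2 (2 * x)\<close> shows that doubling the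
  number of points multiplies the midpoint potential by four, and the constant is \<open>1 / 4\<close> by Euler's sum of
  inverse squares.
\<close>

lemma midpoint_potential_dyadic_2:
  "midpoint_potential (2 ^ k) 2 = zeta_coeff 2 * real (2 ^ k) powr 2"
proof -
  have ker: "circle_kernel 2 t = 1 / (4 * (sin (t / 2))\<^sup>2)" if "sin (t / 2) > 0" for t
    using that by (simp add: circle_kernel_def powr_minus_divide powr_numeral power_mult_distrib)
  have double: "midpoint_potential (2 * n) 2 = 4 * midpoint_potential n 2" if n: "n > 0" for n
  proof -
    define t where "t j = (2 * real j + 1) * pi / real (2 * n)" for j
    have "midpoint_potential (2 * n) 2 = (\<Sum>j<n. circle_kernel 2 (t j)) + (\<Sum>j<n. circle_kernel 2 (t (n + j)))"
      unfolding midpoint_potential_def t_def mult_2 sum_lessThan_add ..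
    also have "\<dots> = (\<Sum>j<n. 4 * circle_kernel 2 ((2 * real j + 1) * pi / real n))"
      unfolding sum.distrib[symmetric]
    proof (intro sum.cong refl)
      fix j assume j: "j \<in> {..<n}"
      define x where "x = t j / 2"
      have t2: "t (n + j) / 2 = x + pi / 2" "(2 * real j + 1) * pi / real n / 2 = 2 * x" "t j / 2 = x"
        using n by (simp_all add: t_def x_def field_simps)
      have "2 * real j + 1 < 2 * real n" using j by auto
      hence "(2 * real j + 1) * pi < 2 * real n * pi" by simp
      hence "x < pi / 2" using n by (simp add: x_def t_def field_simps)
      moreover have "0 < x" unfolding x_def t_def using n by (intro divide_pos_pos mult_pos_pos) auto
      ultimately have x: "0 < x" "x < pi / 2" by auto
      hence pos: "sin x > 0" "cos x > 0" by (auto intro!: sin_gt_zero cos_gt_zero)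
      have "circle_kernel 2 (t j) + circle_kernel 2 (t (n + j)) = 1 / (4 * (sin x)\<^sup>2) + 1 / (4 * (cos x)\<^sup>2)"
        using pos by (subst (1 2) ker) (auto simp: t2 sin_add)
      also have "\<dots> = ((cos x)\<^sup>2 + (sin x)\<^sup>2) / (4 * (sin x)\<^sup>2 * (cos x)\<^sup>2)"
        using pos by (simp add: field_simps)
      also have "\<dots> = 4 * (1 / (4 * (sin (2 * x))\<^sup>2))"
        unfolding sin_double by (simp add: power_mult_distrib)
      also have "\<dots> = 4 * circle_kernel 2 ((2 * real j + 1) * pi / real n)"
      proof -
        have "sin (2 * x) > 0" using pos by (simp add: sin_double)
        thus ?thesis using ker[of "(2 * real j + 1) * pi / real n"] unfolding t2(2) by (simp only:)
      qed
      finally show "circle_kernel 2 (t j) + circle_kernel 2 (t (n + j)) = 4 * circle_kernel 2 ((2 * real j + 1) * pi / real n)" .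
    qed
    finally show ?thesis by (simp add: midpoint_potential_def sum_distrib_left)
  qed
  have P: "midpoint_potential (2 ^ k) 2 = (real (2 ^ k))\<^sup>2 / 4"
  proof (induction k)
    case 0
    show ?case by (simp add: midpoint_potential_def ker)
  next
    case (Suc k)
    show ?case using double[of "2 ^ k"] Suc by (simp add: power2_eq_square)
  qed
  have z: "zeta_coeff 2 = 1 / 4"
  proof -
    have "(\<lambda>n. real (Suc n) powr (- 2)) sums (pi\<^sup>2 / 6)"
      using inverse_squares_sums by (simp add: powr_minus_divide powr_numeral add.commute)
    hence "Re (riemann_zeta (of_real 2)) = pi\<^sup>2 / 6"
      using riemann_zeta_real_sums[of 2] sums_unique2 by fastforce
    thus ?thesis by (simp add: zeta_coeff_def powr_numeral power_mult_distrib)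
  qed
  show ?thesis unfolding P z by (simp add: powr_numeral)
qed

text \<open>
  Every point of \<open>{j..j + 1}\<close> is at most twice \<open>j + 1/2\<close>, so up to the factor \<open>2 powr p\<close> a term is bounded
  by the increment of \<open>A\<close>. The summand \<open>1\<close> stands for \<open>j = 0\<close>, where \<open>A\<close> may be singular.
\<close>

lemma half_integer_sum_le:
  fixes A :: "real \<Rightarrow> real"
  assumes p: "p \<ge> 0" and A: "\<And>y. y > 0 \<Longrightarrow> (A has_real_derivative y powr (- p)) (at y)" and M: "M \<ge> 1"
  shows "(\<Sum>j<M. (real j + 1/2) powr (- p)) \<le> 2 powr p * (1 + A (real M) - A 1)"
  using M
proof (induction M rule: dec_induct)
  case base
  have "(1 / 2 :: real) powr (- p) = 2 powr p" by (simp add: powr_divide powr_minus_divide)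
  thus ?case by simp
next
  case (step n)
  have "\<exists>z. real n < z \<and> z < real n + 1 \<and> A (real n + 1) - A (real n) = (real n + 1 - real n) * z powr (- p)"
    by (rule MVT2) (use step A in auto)
  then obtain z where z: "real n < z" "z < real n + 1" "A (real n + 1) - A (real n) = z powr (- p)" by auto
  have "(real n + 1/2) powr (- p) \<le> (z / 2) powr (- p)"
    using z p step by (intro powr_mono2') auto
  also have "\<dots> = 2 powr p * z powr (- p)" by (simp add: powr_divide powr_minus_divide)
  finally show ?case using step.IH z(3) by (simp add: algebra_simps)
qed

text \<open>
  For \<open>s > 1\<close> the error for \<open>x = 2 ^ k\<close> points is of order \<open>x * error_growth s x\<close>. The factor \<open>x\<close> is
  split off because the second factor is monotone: summed over the binary digits of \<open>N\<close>, the errors are then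
  bounded by \<open>N * error_growth s N\<close>.
\<close>

definition error_growth :: "real \<Rightarrow> real \<Rightarrow> real" where
  "error_growth s x = (if s < 3 then 1 else if s = 3 then 1 + ln x else x powr (s - 3))"

lemma error_growth_mono: "1 \<le> x \<Longrightarrow> x \<le> y \<Longrightarrow> error_growth s x \<le> error_growth s y"
  by (auto simp: error_growth_def intro!: powr_mono2)

lemma error_growth_ge_1: "1 \<le> x \<Longrightarrow> 1 \<le> error_growth s x"
  by (auto simp: error_growth_def intro!: ge_one_powr_ge_zero)

text \<open>
  The defect is of order \<open>t powr (2 - s)\<close>. For \<open>s \<le> 2\<close> this is bounded; for \<open>s > 2\<close> scaling leaves a sum of
  \<open>(j + 1/2) powr (- p)\<close> with \<open>p = s - 2\<close>, and the three regimes of \<open>error_growth\<close> are \<open>p < 1\<close>, \<open>p = 1\<close>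
  and \<open>p > 1\<close>.
\<close>

lemma sum_kernel_defect_bound:
  assumes s: "s > 1"
  shows "\<exists>C. \<forall>M\<ge>1. \<bar>\<Sum>j<M. kernel_defect s ((real j + 1/2) * (pi / real M))\<bar> \<le> C * (real M * error_growth s (real M))"
proof -
  define K where "K = s * 2 powr (s + 1)"
  have K: "K > 0" using s by (simp add: K_def)
  have bound: "\<bar>\<Sum>j<M. kernel_defect s ((real j + 1/2) * (pi / real M))\<bar>
      \<le> K * (\<Sum>j<M. ((real j + 1/2) * (pi / real M)) powr (2 - s))" if M: "M \<ge> 1" for M
    unfolding sum_distrib_left
  proof (intro order_trans[OF sum_abs] sum_mono)
    fix j assume j: "j \<in> {..<M}"
    have "real j + 1/2 \<le> real M" using j by auto
    hence "(real j + 1/2) * (pi / real M) \<le> real M * (pi / real M)" by (intro mult_right_mono) auto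
    hence "0 < (real j + 1/2) * (pi / real M)" "(real j + 1/2) * (pi / real M) \<le> pi" using M by auto
    from circle_kernel_minus_powr[OF this, of s] s
    show "\<bar>kernel_defect s ((real j + 1/2) * (pi / real M))\<bar> \<le> K * ((real j + 1/2) * (pi / real M)) powr (2 - s)"
      by (simp add: kernel_defect_def K_def)
  qed
  have scale: "((real j + 1/2) * (pi / real M)) powr (2 - s) = (real M / pi) powr (s - 2) * (real j + 1/2) powr (- (s - 2))" if "M \<ge> 1" for j M
  proof -
    have "2 - s = - (s - 2)" by simp
    hence "(pi / real M) powr (2 - s) = (real M / pi) powr (s - 2)"
      using that by (simp only: powr_minus_divide powr_divide) simp
    thus ?thesis by (simp only: powr_mult minus_diff_eq mult.commute)
  qed
  have "\<exists>B. \<forall>M\<ge>1. (\<Sum>j<M. ((real j + 1/2) * (pi / real M)) powr (2 - s)) \<le> B * (real M * error_growth s (real M))"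
  proof (cases "s \<le> 2")
    case True
    have "(\<Sum>j<M. ((real j + 1/2) * (pi / real M)) powr (2 - s)) \<le> pi powr (2 - s) * (real M * error_growth s (real M))"
      if M: "M \<ge> 1" for M
    proof -
      have "(\<Sum>j<M. ((real j + 1/2) * (pi / real M)) powr (2 - s)) \<le> (\<Sum>j<M. pi powr (2 - s))"
      proof (intro sum_mono powr_mono2)
        fix j assume j: "j \<in> {..<M}"
        have "real j + 1/2 \<le> real M" using j by auto
        hence "(real j + 1/2) * (pi / real M) \<le> real M * (pi / real M)" by (intro mult_right_mono) auto
        thus "(real j + 1/2) * (pi / real M) \<le> pi" using M by auto
      qed (use True in auto)
      thus ?thesis using True by (simp add: error_growth_def mult.commute)
    qed
    thus ?thesis by blast
  next
    case False
    define p where "p = s - 2"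
    have p: "p > 0" using False by (simp add: p_def)
    have pM: "(real M / pi) powr p \<le> real M powr p" if "M \<ge> 1" for M
    proof (rule powr_mono2)
      have "real M * 1 \<le> real M * pi" using pi_gt3 by (intro mult_left_mono) auto
      thus "real M / pi \<le> real M" by (simp add: divide_le_eq)
    qed (use p in auto)
    have "\<exists>B. \<forall>M\<ge>1. real M powr p * (\<Sum>j<M. (real j + 1/2) powr (- p)) \<le> B * (real M * error_growth s (real M))"
    proof (cases "p = 1")
      case True
      have "real M powr p * (\<Sum>j<M. (real j + 1/2) powr (- p)) \<le> 2 * (real M * error_growth s (real M))" if M: "M \<ge> 1" for M
      proof -
        have "(\<Sum>j<M. (real j + 1/2) powr (- p)) \<le> 2 powr p * (1 + ln (real M) - ln 1)"
          by (rule half_integer_sum_le) (use p M True DERIV_ln in \<open>auto simp: powr_minus\<close>)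
        hence "real M * (\<Sum>j<M. (real j + 1/2) powr (- p)) \<le> real M * (2 powr p * (1 + ln (real M) - ln 1))"
          by (intro mult_left_mono) auto
        thus ?thesis using True M by (simp add: error_growth_def p_def)
      qed
      thus ?thesis by blast
    next
      case False
      have le: "(\<Sum>j<M. (real j + 1/2) powr (- p)) \<le> 2 powr p * (1 + real M powr (1 - p) / (1 - p) - 1 / (1 - p))"
        if M: "M \<ge> 1" for M
        using half_integer_sum_le[OF _ powr_antiderivative[OF False] M] p by simp
      show ?thesis
      proof (cases "p < 1")
        case True
        have "real M powr p * (\<Sum>j<M. (real j + 1/2) powr (- p)) \<le> 2 powr p * (1 + 1 / (1 - p)) * (real M * error_growth s (real M))"
          if M: "M \<ge> 1" for M
        proof -
          have "1 \<le> real M powr (1 - p)" using M True by (intro ge_one_powr_ge_zero) auto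
          moreover have "0 \<le> 1 / (1 - p)" using True by simp
          moreover have "1 + q * x - q \<le> (1 + q) * x" if "1 \<le> x" "0 \<le> q" for q x :: real
            using that by (simp add: algebra_simps)
          ultimately have "1 + 1 / (1 - p) * real M powr (1 - p) - 1 / (1 - p) \<le> (1 + 1 / (1 - p)) * real M powr (1 - p)"
            by blast
          hence "1 + real M powr (1 - p) / (1 - p) - 1 / (1 - p) \<le> (1 + 1 / (1 - p)) * real M powr (1 - p)"
            by (simp only: times_divide_eq_left mult_1)
          hence "2 powr p * (1 + real M powr (1 - p) / (1 - p) - 1 / (1 - p)) \<le> 2 powr p * ((1 + 1 / (1 - p)) * real M powr (1 - p))"
            by (intro mult_left_mono) auto
          hence "(\<Sum>j<M. (real j + 1/2) powr (- p)) \<le> 2 powr p * ((1 + 1 / (1 - p)) * real M powr (1 - p))"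
            using le[OF M] by linarith
          hence "real M powr p * (\<Sum>j<M. (real j + 1/2) powr (- p)) \<le> real M powr p * (2 powr p * ((1 + 1 / (1 - p)) * real M powr (1 - p)))"
            by (intro mult_left_mono) auto
          also have "\<dots> = 2 powr p * (1 + 1 / (1 - p)) * (real M powr p * real M powr (1 - p))" by (simp only: mult_ac)
          also have "real M powr p * real M powr (1 - p) = real M" using M by (simp add: powr_add[symmetric])
          finally show ?thesis using True by (simp add: error_growth_def p_def)
        qed
        thus ?thesis by blast
      next
        case p1: False
        hence p1: "p > 1" using False by simp
        have "real M powr p * (\<Sum>j<M. (real j + 1/2) powr (- p)) \<le> 2 powr p * (1 + 1 / (p - 1)) * (real M * error_growth s (real M))"
          if M: "M \<ge> 1" for M
        proof -
          have e: "1 / (1 - p) = - (1 / (p - 1))" "real M powr (1 - p) / (1 - p) \<le> 0"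
            using p1 by (simp_all add: divide_nonneg_neg minus_divide_right)
          have "2 powr p * (1 + real M powr (1 - p) / (1 - p) - 1 / (1 - p)) \<le> 2 powr p * (1 + 1 / (p - 1))"
            using e by (intro mult_left_mono) auto
          hence "(\<Sum>j<M. (real j + 1/2) powr (- p)) \<le> 2 powr p * (1 + 1 / (p - 1))" using le[OF M] by linarith
          hence "real M powr p * (\<Sum>j<M. (real j + 1/2) powr (- p)) \<le> real M powr p * (2 powr p * (1 + 1 / (p - 1)))"
            by (intro mult_left_mono) auto
          moreover have "real M powr p = real M * error_growth s (real M)"
            using p1 M powr_add[of "real M" 1 "s - 3"] by (simp add: error_growth_def p_def)
          ultimately show ?thesis by (simp only: mult_ac)
        qed
        thus ?thesis by blast
      qed
    qed
    then obtain B where B: "\<And>M. M \<ge> 1 \<Longrightarrow> real M powr p * (\<Sum>j<M. (real j + 1/2) powr (- p)) \<le> B * (real M * error_growth s (real M))"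
      by blast
    have "(\<Sum>j<M. ((real j + 1/2) * (pi / real M)) powr (2 - s)) \<le> B * (real M * error_growth s (real M))" if M: "M \<ge> 1" for M
    proof -
      have "(\<Sum>j<M. ((real j + 1/2) * (pi / real M)) powr (2 - s)) = (real M / pi) powr p * (\<Sum>j<M. (real j + 1/2) powr (- p))"
        unfolding scale[OF M] p_def sum_distrib_left ..
      also have "\<dots> \<le> real M powr p * (\<Sum>j<M. (real j + 1/2) powr (- p))"
        using pM[OF M] by (intro mult_right_mono sum_nonneg) auto
      finally show ?thesis using B[OF M] by linarith
    qed
    thus ?thesis by blast
  qed
  then obtain B where B: "\<And>M. M \<ge> 1 \<Longrightarrow> (\<Sum>j<M. ((real j + 1/2) * (pi / real M)) powr (2 - s)) \<le> B * (real M * error_growth s (real M))"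
    by blast
  have "\<bar>\<Sum>j<M. kernel_defect s ((real j + 1/2) * (pi / real M))\<bar> \<le> K * B * (real M * error_growth s (real M))" if M: "M \<ge> 1" for M
  proof -
    have "K * (\<Sum>j<M. ((real j + 1/2) * (pi / real M)) powr (2 - s)) \<le> K * (B * (real M * error_growth s (real M)))"
      using B[OF M] K by (intro mult_left_mono) auto
    from order_trans[OF bound[OF M] this] show ?thesis by (simp only: mult.assoc)
  qed
  thus ?thesis by blast
qed

text \<open>
  For \<open>s > 1\<close> the Dirichlet sum gives the main term up to its tail \<open>M powr (1 - s)\<close>, which contributes an
  error linear in \<open>M\<close>, and the sum of the defects is another error term.
\<close>

lemma midpoint_potential_dyadic_gt_1:
  assumes s: "s > 1"
  shows "\<exists>C\<ge>0. \<forall>k. \<bar>midpoint_potential (2 ^ k) s - zeta_coeff s * real (2 ^ k) powr s\<bar>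
     \<le> C * (real (2 ^ k) * error_growth s (real (2 ^ k)))"
proof -
  define L where "L = (2 powr s - 1) * Re (riemann_zeta (of_real s))"
  obtain C1 where C1: "\<And>M. M \<ge> 1 \<Longrightarrow> \<bar>\<Sum>j<M. kernel_defect s ((real j + 1/2) * (pi / real M))\<bar> \<le> C1 * (real M * error_growth s (real M))"
    using sum_kernel_defect_bound[OF s] by blast
  obtain C2 where C2: "\<And>M. M \<ge> 1 \<Longrightarrow> \<bar>(\<Sum>j<M. (real j + 1/2) powr (- s)) - real M powr (1 - s) / (1 - s) - L\<bar> \<le> C2 * real M powr (- s - 1)"
    using half_integer_sum_rate[OF _ powr_antiderivative half_integer_sum_limit, of s] s unfolding L_def by auto
  have "C1 \<ge> 0"
  proof -
    have "0 \<le> C1 * error_growth s 1" using C1[of 1] by simp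
    thus ?thesis using error_growth_ge_1[of 1 s] by (simp add: zero_le_mult_iff)
  qed
  have "C2 \<ge> 0" using C2[of 1] by simp
  show ?thesis
  proof (rule dyadic_bound)
    fix M :: nat assume M: "M \<ge> 1"
    define X Y where "X = (\<Sum>j<M. kernel_defect s ((real j + 1/2) * (pi / real M)))" and "Y = (\<Sum>j<M. (real j + 1/2) powr (- s))"
    have m: "real M \<ge> 1" using M by simp
    have eg: "1 \<le> error_growth s (real M)" "error_growth s (real M) \<le> error_growth s (real (2 * M))"
      using M by (auto intro!: error_growth_ge_1 error_growth_mono)
    have "\<bar>Y - L\<bar> \<le> \<bar>Y - real M powr (1 - s) / (1 - s) - L\<bar> + \<bar>real M powr (1 - s) / (1 - s)\<bar>" by linarith
    also have "\<dots> \<le> C2 * real M powr (- s - 1) + real M powr (1 - s) / (s - 1)"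
      using C2[OF M] s by (intro add_mono) (auto simp: Y_def)
    also have "\<dots> \<le> C2 * real M powr (1 - s) + real M powr (1 - s) / (s - 1)"
      using m \<open>C2 \<ge> 0\<close> by (intro add_right_mono mult_left_mono powr_mono) auto
    finally have Y: "\<bar>Y - L\<bar> \<le> (C2 + 1 / (s - 1)) * real M powr (1 - s)"
      using \<open>C2 \<ge> 0\<close> by (simp add: algebra_simps)
    have Y': "(real M / pi) powr s * \<bar>Y - L\<bar> \<le> (C2 + 1 / (s - 1)) * real M"
    proof -
      have "(real M / pi) powr s * \<bar>Y - L\<bar> \<le> real M powr s * ((C2 + 1 / (s - 1)) * real M powr (1 - s))"
      proof (intro mult_mono Y powr_mono2)
        have "real M * 1 \<le> real M * pi" using pi_gt3 by (intro mult_left_mono) auto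
        thus "real M / pi \<le> real M" by (simp add: divide_le_eq)
      qed (use s in auto)
      also have "\<dots> = (C2 + 1 / (s - 1)) * (real M powr s * real M powr (1 - s))" by (simp only: mult_ac)
      also have "real M powr s * real M powr (1 - s) = real M" using M by (simp add: powr_add[symmetric])
      finally show ?thesis .
    qed
    have "midpoint_potential (2 * M) s - zeta_coeff s * real (2 * M) powr s = 2 * X + 2 * ((real M / pi) powr s * (Y - L))"
      unfolding midpoint_potential_double[OF M] zeta_coeff_double X_def Y_def L_def by (simp add: algebra_simps)
    also have "\<bar>\<dots>\<bar> \<le> 2 * \<bar>X\<bar> + 2 * ((real M / pi) powr s * \<bar>Y - L\<bar>)"
      by (simp add: order_trans[OF abs_triangle_ineq] abs_mult)
    also have "\<dots> \<le> 2 * (C1 * (real M * error_growth s (real M))) + 2 * ((C2 + 1 / (s - 1)) * real M)"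
      using C1[OF M] Y' by (simp add: X_def)
    also have "\<dots> \<le> 2 * (C1 * (real M * error_growth s (real M))) + 2 * ((C2 + 1 / (s - 1)) * (real M * error_growth s (real M)))"
      using eg(1) \<open>C2 \<ge> 0\<close> s m by (intro add_left_mono mult_left_mono) auto
    also have "\<dots> = (C1 + C2 + 1 / (s - 1)) * (2 * real M * error_growth s (real M))" by (simp add: algebra_simps)
    also have "\<dots> \<le> (C1 + C2 + 1 / (s - 1)) * (2 * real M * error_growth s (real (2 * M)))"
      using eg(2) \<open>C1 \<ge> 0\<close> \<open>C2 \<ge> 0\<close> s by (intro mult_left_mono) auto
    finally show "\<bar>midpoint_potential (2 * M) s - zeta_coeff s * real (2 * M) powr s\<bar>
        \<le> (C1 + C2 + 1 / (s - 1)) * (real (2 * M) * error_growth s (real (2 * M)))" by simp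
  next
    fix n :: nat assume "n \<ge> 1"
    thus "real n * error_growth s (real n) > 0" using error_growth_ge_1[of "real n" s] by (intro mult_pos_pos) auto
  qed
qed

section \<open>Binary digits and the final estimate\<close>

lemma sum_list_binary_exponents:
  fixes f :: "nat \<Rightarrow> 'a :: comm_monoid_add"
  shows "(\<Sum>n\<leftarrow>binary_exponents N. f n) = (\<Sum>k | bit N k. f k)"
proof -
  have "(\<Sum>n\<leftarrow>binary_exponents N. f n) = (\<Sum>n\<leftarrow>filter (bit N) [0..<N]. f n)"
    unfolding binary_exponents_def by (simp add: rev_map[symmetric] sum_list_rev)
  also have "\<dots> = (\<Sum>k\<in>set (filter (bit N) [0..<N]). f k)"
    by (rule sum_list_distinct_conv_sum_set) simp
  also have "set (filter (bit N) [0..<N]) = {k. bit N k}"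
  proof -
    have "k < N" if "bit N k" for k
      using bit_nat_imp_power_le[OF that] less_exp[of k] by linarith
    thus ?thesis by auto
  qed
  finally show ?thesis .
qed

lemma sum_bits: "(\<Sum>k | bit N k. real (2 ^ k)) = real N"
  using sum_binary_exponents[of N] unfolding sum_list_binary_exponents by (metis of_nat_sum)

lemma G_eta: "G (eta N) s = (\<Sum>k | bit N k. real (2 ^ k) powr s) / real N powr s"
proof -
  have "G (eta N) s = (\<Sum>k | bit N k. (2 ^ k / real N) powr s)"
    unfolding G_def eta_def by (simp add: o_def sum_list_binary_exponents)
  also have "\<dots> = (\<Sum>k | bit N k. real (2 ^ k) powr s / real N powr s)"
    by (simp add: powr_divide)
  finally show ?thesis by (simp add: sum_divide_distrib)
qed

lemma Lambda_eta:
  assumes "N > 0"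
  shows "Lambda (eta N) = (\<Sum>k | bit N k. real (2 ^ k) * ln (real (2 ^ k))) / real N - ln (real N)"
proof -
  have "Lambda (eta N) = (\<Sum>k | bit N k. 2 ^ k / real N * ln (2 ^ k / real N))"
    unfolding Lambda_def eta_def by (simp add: o_def sum_list_binary_exponents)
  also have "\<dots> = (\<Sum>k | bit N k. real (2 ^ k) * ln (real (2 ^ k)) / real N - real (2 ^ k) * (ln (real N) / real N))"
  proof (intro sum.cong refl)
    fix k
    have "ln (2 ^ k / real N) = ln (real (2 ^ k)) - ln (real N)" using assms by (simp add: ln_div)
    thus "2 ^ k / real N * ln (2 ^ k / real N) = real (2 ^ k) * ln (real (2 ^ k)) / real N - real (2 ^ k) * (ln (real N) / real N)"
      by (simp add: diff_divide_distrib right_diff_distrib)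
  qed
  also have "\<dots> = (\<Sum>k | bit N k. real (2 ^ k) * ln (real (2 ^ k))) / real N - real N * (ln (real N) / real N)"
    unfolding sum_subtractf sum_divide_distrib[symmetric] sum_distrib_right[symmetric] sum_bits ..
  finally show ?thesis using assms by simp
qed

text \<open>
  Different binary digits carry different exponents, so errors that decay geometrically have a bounded
  sum, independently of the number of digits.
\<close>

lemma sum_bits_inverse_sqrt_le: "\<exists>S. \<forall>N. (\<Sum>k | bit (N::nat) k. 1 / sqrt (real (2 ^ k))) \<le> S"
proof (intro exI allI)
  fix N :: nat
  have eq: "1 / sqrt (real (2 ^ k)) = (1 / sqrt 2) ^ k" for k
    by (simp add: real_sqrt_power power_divide)
  have "(\<Sum>k | bit N k. (1 / sqrt 2 :: real) ^ k) \<le> (\<Sum>k. (1 / sqrt 2) ^ k)"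
    by (rule sum_le_suminf) (auto intro!: summable_geometric finite_bits_nat)
  thus "(\<Sum>k | bit N k. 1 / sqrt (real (2 ^ k))) \<le> (\<Sum>k. (1 / sqrt 2) ^ k)"
    unfolding eq .
qed

lemma greedy_value_asymp:
  fixes N :: nat
  assumes "\<And>k. \<bar>midpoint_potential (2 ^ k) s - f k\<bar> \<le> C * g k"
  shows "\<bar>greedy_value s N - (\<Sum>k | bit N k. f k)\<bar> \<le> C * (\<Sum>k | bit N k. g k)"
proof -
  have "\<bar>greedy_value s N - (\<Sum>k | bit N k. f k)\<bar> \<le> (\<Sum>k | bit N k. \<bar>midpoint_potential (2 ^ k) s - f k\<bar>)"
    unfolding greedy_value_def sum_subtractf[symmetric] by (rule sum_abs)
  also have "\<dots> \<le> (\<Sum>k | bit N k. C * g k)" by (intro sum_mono assms)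
  finally show ?thesis by (simp add: sum_distrib_left)
qed

lemma F_bound_lt_1:
  assumes s: "0 < s" "s < 1" and a: "greedy_energy_sequence s a"
  shows "\<exists>C. \<forall>N>0. \<bar>F s a N - zeta_coeff s * G (eta N) s\<bar> \<le> C * real N powr (- s)"
proof -
  obtain J where J: "(circle_kernel s has_integral J) {0..pi}"
    using circle_kernel_has_integral[OF s] by blast
  have "J \<ge> 0" using J by (rule has_integral_nonneg) (simp add: circle_kernel_nonneg)
  obtain C where C: "C \<ge> 0" "\<And>k. \<bar>midpoint_potential (2 ^ k) s - (real (2 ^ k) * (J / pi) + zeta_coeff s * real (2 ^ k) powr s)\<bar>
     \<le> C * (1 / sqrt (real (2 ^ k)))"
    using midpoint_potential_dyadic_lt_1[OF s J] by blast
  obtain S where S: "\<And>N::nat. (\<Sum>k | bit N k. 1 / sqrt (real (2 ^ k))) \<le> S" using sum_bits_inverse_sqrt_le by blast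
  have "\<bar>F s a N - zeta_coeff s * G (eta N) s\<bar> \<le> C * S * real N powr (- s)" if N: "N > 0" for N
  proof -
    have F: "F s a N = (greedy_value s N - real N * (J / pi)) / real N powr s"
      using s \<open>J \<ge> 0\<close> unfolding F_def greedy_potential_eq[OF s(1) a] riesz_energy_arclength_prob[OF s(1) J]
      by (simp add: greedy_value_nonneg)
    have sum: "(\<Sum>k | bit N k. real (2 ^ k) * (J / pi) + zeta_coeff s * real (2 ^ k) powr s)
       = real N * (J / pi) + zeta_coeff s * (\<Sum>k | bit N k. real (2 ^ k) powr s)"
      unfolding sum.distrib sum_distrib_right[symmetric] sum_distrib_left[symmetric] sum_bits ..
    have "F s a N - zeta_coeff s * G (eta N) s
       = (greedy_value s N - (\<Sum>k | bit N k. real (2 ^ k) * (J / pi) + zeta_coeff s * real (2 ^ k) powr s)) / real N powr s"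
      unfolding F G_eta sum by (simp add: diff_divide_distrib add_divide_distrib)
    also have "\<bar>\<dots>\<bar> \<le> C * (\<Sum>k | bit N k. 1 / sqrt (real (2 ^ k))) / real N powr s"
      using greedy_value_asymp[OF C(2), of N] by (simp add: divide_right_mono)
    also have "\<dots> \<le> C * S / real N powr s"
      using S C(1) by (intro divide_right_mono mult_left_mono) auto
    finally show ?thesis by (simp add: powr_minus divide_inverse)
  qed
  thus ?thesis by blast
qed

lemma F_bound_1:
  assumes a: "greedy_energy_sequence 1 a"
  shows "\<exists>C. \<forall>N>0. \<bar>F 1 a N - 1 / pi * (euler_mascheroni + ln (8 / pi) + Lambda (eta N))\<bar> \<le> C * (1 / real N)"
proof -
  define c where "c = euler_mascheroni + ln (8 / pi)"
  obtain C where C: "C \<ge> 0" "\<And>k. \<bar>midpoint_potential (2 ^ k) 1 - real (2 ^ k) / pi * (ln (real (2 ^ k)) + euler_mascheroni + ln (8 / pi))\<bar>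
     \<le> C * (1 / sqrt (real (2 ^ k)))"
    using midpoint_potential_dyadic_1 by blast
  obtain S where S: "\<And>N::nat. (\<Sum>k | bit N k. 1 / sqrt (real (2 ^ k))) \<le> S" using sum_bits_inverse_sqrt_le by blast
  have "\<bar>F 1 a N - 1 / pi * (c + Lambda (eta N))\<bar> \<le> C * S * (1 / real N)" if N: "N > 0" for N
  proof -
    define E where "E = (\<Sum>k | bit N k. real (2 ^ k) * ln (real (2 ^ k)))"
    have F: "F 1 a N = (greedy_value 1 N - real N * ln (real N) / pi) / real N"
      unfolding F_def greedy_potential_eq[OF zero_less_one a] by (simp add: greedy_value_nonneg)
    have "(\<Sum>k | bit N k. real (2 ^ k) / pi * (ln (real (2 ^ k)) + euler_mascheroni + ln (8 / pi)))
       = (\<Sum>k | bit N k. real (2 ^ k) * ln (real (2 ^ k)) * (1 / pi) + real (2 ^ k) * (c / pi))"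
      by (intro sum.cong refl) (simp add: c_def field_simps)
    also have "\<dots> = E * (1 / pi) + real N * (c / pi)"
      unfolding sum.distrib sum_distrib_right[symmetric] sum_bits E_def ..
    finally have sum: "(\<Sum>k | bit N k. real (2 ^ k) / pi * (ln (real (2 ^ k)) + euler_mascheroni + ln (8 / pi)))
       = E * (1 / pi) + real N * (c / pi)" .
    have "F 1 a N - 1 / pi * (c + Lambda (eta N))
       = (greedy_value 1 N - (\<Sum>k | bit N k. real (2 ^ k) / pi * (ln (real (2 ^ k)) + euler_mascheroni + ln (8 / pi)))) / real N"
      unfolding F sum Lambda_eta[OF N] E_def[symmetric] using N by (simp add: field_simps)
    also have "\<bar>\<dots>\<bar> \<le> C * (\<Sum>k | bit N k. 1 / sqrt (real (2 ^ k))) / real N"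
      using greedy_value_asymp[OF C(2), of N] by (simp add: divide_right_mono)
    also have "\<dots> \<le> C * S / real N"
      using S C(1) by (intro divide_right_mono mult_left_mono) auto
    finally show ?thesis by simp
  qed
  thus ?thesis unfolding c_def by blast
qed

lemma F_gt_1:
  assumes s: "s > 1" and a: "greedy_energy_sequence s a"
  shows "F s a N - zeta_coeff s * G (eta N) s
     = (greedy_value s N - (\<Sum>k | bit N k. zeta_coeff s * real (2 ^ k) powr s)) / real N powr s"
proof -
  have s0: "s > 0" using s by simp
  have "F s a N = greedy_value s N / real N powr s"
    using s unfolding F_def greedy_potential_eq[OF s0 a] by (simp add: greedy_value_nonneg)
  thus ?thesis unfolding G_eta by (simp add: diff_divide_distrib sum_distrib_left)
qed

lemma F_bound_gt_1:
  assumes s: "s > 1" and a: "greedy_energy_sequence s a"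
  shows "\<exists>C. \<forall>N>0. \<bar>F s a N - zeta_coeff s * G (eta N) s\<bar> \<le> C * (real N powr (1 - s) * error_growth s (real N))"
proof -
  obtain C where C: "C \<ge> 0" "\<And>k. \<bar>midpoint_potential (2 ^ k) s - zeta_coeff s * real (2 ^ k) powr s\<bar>
     \<le> C * (real (2 ^ k) * error_growth s (real (2 ^ k)))"
    using midpoint_potential_dyadic_gt_1[OF s] by blast
  have "\<bar>F s a N - zeta_coeff s * G (eta N) s\<bar> \<le> C * (real N powr (1 - s) * error_growth s (real N))" if N: "N > 0" for N
  proof -
    have "(\<Sum>k | bit N k. real (2 ^ k) * error_growth s (real (2 ^ k))) \<le> (\<Sum>k | bit N k. real (2 ^ k) * error_growth s (real N))"
    proof (intro sum_mono mult_left_mono error_growth_mono)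
      fix k assume "k \<in> {k. bit N k}"
      thus "real (2 ^ k) \<le> real N" using bit_nat_imp_power_le[of N k] by (simp only: of_nat_le_iff mem_Collect_eq)
    qed auto
    also have "\<dots> = real N * error_growth s (real N)" unfolding sum_distrib_right[symmetric] sum_bits ..
    finally have le: "(\<Sum>k | bit N k. real (2 ^ k) * error_growth s (real (2 ^ k))) \<le> real N * error_growth s (real N)" .
    have "\<bar>F s a N - zeta_coeff s * G (eta N) s\<bar>
        \<le> C * (\<Sum>k | bit N k. real (2 ^ k) * error_growth s (real (2 ^ k))) / real N powr s"
      unfolding F_gt_1[OF s a] using greedy_value_asymp[OF C(2), of N] by (simp add: divide_right_mono)
    also have "\<dots> \<le> C * (real N * error_growth s (real N)) / real N powr s"
      using le C(1) by (intro divide_right_mono mult_left_mono) auto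
    also have "\<dots> = C * (real N / real N powr s * error_growth s (real N))" by simp
    also have "real N / real N powr s = real N powr (1 - s)" using N by (simp add: powr_diff)
    finally show ?thesis .
  qed
  thus ?thesis by blast
qed

lemma F_eq_2:
  assumes "greedy_energy_sequence 2 a"
  shows "F 2 a N - zeta_coeff 2 * G (eta N) 2 = 0"
  by (subst F_gt_1[OF _ assms]) (simp_all add: greedy_value_def midpoint_potential_dyadic_2)

lemma bigo_of_pos_bound:
  fixes f g :: "nat \<Rightarrow> real"
  assumes "\<exists>C. \<forall>N>0. \<bar>f N\<bar> \<le> C * g N"
  shows "f \<in> O[sequentially](g)"
proof -
  obtain C where C: "\<And>N. N > 0 \<Longrightarrow> \<bar>f N\<bar> \<le> C * g N" using assms by blast
  show ?thesis
  proof (rule bigoI[where c = "\<bar>C\<bar>"])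
    show "\<forall>\<^sub>F N in sequentially. norm (f N) \<le> \<bar>C\<bar> * norm (g N)"
      using eventually_gt_at_top[of "0::nat"]
    proof eventually_elim
      case (elim N)
      have "\<bar>f N\<bar> \<le> \<bar>C * g N\<bar>" using C[OF elim] by linarith
      thus ?case by (simp add: abs_mult)
    qed
  qed
qed

theorem theorem1p2:
  fixes s :: real and a :: "nat \<Rightarrow> complex"
  assumes "s > 0" and "greedy_energy_sequence s a"
  shows "(s \<noteq> 1 \<longrightarrow>
           (\<lambda>N. F s a N - (2 powr s - 1) * (2 * Re (riemann_zeta (of_real s)) / (2 * pi) powr s) * G (eta N) s)
             \<in> O[sequentially](\<lambda>N.
                 if s < 1 then real N powr (- s)
                 else if s < 3 \<and> s \<noteq> 2 then real N powr (1 - s)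
                 else if s = 3 then real N powr (- 2) * ln (real N)
                 else real N powr (- 2))) \<and>
         (s = 1 \<longrightarrow>
           (\<lambda>N. F s a N - 1 / pi * (euler_mascheroni + ln (8 / pi) + Lambda (eta N)))
             \<in> O[sequentially](\<lambda>N. 1 / real N))"
proof (intro conjI impI)
  assume "s = 1"
  thus "(\<lambda>N. F s a N - 1 / pi * (euler_mascheroni + ln (8 / pi) + Lambda (eta N))) \<in> O[sequentially](\<lambda>N. 1 / real N)"
    using F_bound_1[of a] assms(2) by (intro bigo_of_pos_bound) simp
next
  assume s: "s \<noteq> 1"
  define D where "D N = F s a N - zeta_coeff s * G (eta N) s" for N
  have "D \<in> O[sequentially](\<lambda>N. if s < 1 then real N powr (- s)
                 else if s < 3 \<and> s \<noteq> 2 then real N powr (1 - s)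
                 else if s = 3 then real N powr (- 2) * ln (real N)
                 else real N powr (- 2))"
  proof (cases "s < 1")
    case True
    thus ?thesis using F_bound_lt_1[OF assms(1) True assms(2)]
      by (simp add: D_def[abs_def]) (rule bigo_of_pos_bound, simp)
  next
    case False
    hence s1: "s > 1" using s by simp
    have D: "D \<in> O[sequentially](\<lambda>N. real N powr (1 - s) * error_growth s (real N))"
      unfolding D_def[abs_def] by (rule bigo_of_pos_bound[OF F_bound_gt_1[OF s1 assms(2)]])
    consider "s < 3" "s \<noteq> 2" | "s = 2" | "s = 3" | "s > 3" by linarith
    thus ?thesis
    proof cases
      case 1
      thus ?thesis using D s1 by (simp add: error_growth_def)
    next
      case 2
      hence "D = (\<lambda>_. 0)" using F_eq_2[of a] assms(2) by (simp add: D_def[abs_def])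
      thus ?thesis by simp
    next
      case 3
      have "(\<lambda>N. real N powr (1 - 3) * (1 + ln (real N))) \<in> O[sequentially](\<lambda>N. real N powr (- 2) * ln (real N))"
        by real_asymp
      from landau_o.big_trans[OF _ this] show ?thesis using D 3 by (simp add: error_growth_def)
    next
      case 4
      have "real N powr (1 - s) * real N powr (s - 3) = real N powr (- 2)" for N
        by (simp add: powr_add[symmetric])
      thus ?thesis using D 4 by (simp add: error_growth_def)
    qed
  qed
  thus "(\<lambda>N. F s a N - (2 powr s - 1) * (2 * Re (riemann_zeta (of_real s)) / (2 * pi) powr s) * G (eta N) s)
      \<in> O[sequentially](\<lambda>N. if s < 1 then real N powr (- s)
                 else if s < 3 \<and> s \<noteq> 2 then real N powr (1 - s)
                 else if s = 3 then real N powr (- 2) * ln (real N)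
                 else real N powr (- 2))"
    unfolding D_def[abs_def] zeta_coeff_def .
qed

end
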